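(* For every even integer $k \ge 6$ there exist infinitely many (pairwise non-isomorphic) $3$-connected cubic planar graphs $G$ of circumference at least $k$ such that $\mathcal{C}(G) \cap [k, 2k+2] = \emptyset$, i.e.\ $G$ contains no cycle whose length $\ell$ satisfies $k \le \ell \le 2k+2$.
   Context: All graphs are finite and simple. For a graph $G$, the cycle spectrum $\mathcal{C}(G)$ is the set of lengths of cycles in $G$. The circumference of $G$ is the length of a longest cycle in $G$. A graph is cubic if every vertex has degree $3$. *)

theory Defs
  imports "HOL-Analysis.Analysis" "Graph_Theory.Graph_Theory"
begin

text \<open>
  Finite simple graphs are the symmetric digraphs of the locale \<open>pair_graph\<close>: an undirected edge
  is a pair of opposite arcs.
\<close>

text \<open>
  The bound \<open>3 \<le> length p\<close> excludes walking back and forth along a single edge, which is a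
  cycle of the symmetric digraph but not of the undirected graph.
\<close>

definition cycle_spectrum :: "'a pair_pre_digraph \<Rightarrow> nat set" where
  "cycle_spectrum G = {length p | p. pre_digraph.cycle (with_proj G) p \<and> 3 \<le> length p}"

definition circumference :: "'a pair_pre_digraph \<Rightarrow> nat" where
  "circumference G = Max (cycle_spectrum G)"

text \<open>In a symmetric digraph the out-degree is the degree of the undirected graph.\<close>

definition cubic :: "'a pair_pre_digraph \<Rightarrow> bool" where
  "cubic G \<longleftrightarrow> (\<forall>v \<in> pverts G. out_degree (with_proj G) v = 3)"

definition vertex_connected :: "nat \<Rightarrow> 'a pair_pre_digraph \<Rightarrow> bool" where
  "vertex_connected n G \<longleftrightarrow> n < card (pverts G) \<and>
    (\<forall>X \<subseteq> pverts G. card X < n \<longrightarrow>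
      Digraph_Component.connected (with_proj G \<restriction> (pverts G - X)))"

text \<open>
  Curves are indexed by the end-vertex set \<open>{u, v}\<close>, so that both arcs of an edge are drawn as
  the same curve, in either orientation.
\<close>

definition plane_drawing ::
  "'a pair_pre_digraph \<Rightarrow> ('a \<Rightarrow> real \<times> real) \<Rightarrow> ('a set \<Rightarrow> real \<Rightarrow> real \<times> real) \<Rightarrow> bool" where
  "plane_drawing G pos crv \<longleftrightarrow>
    inj_on pos (pverts G) \<and>
    (\<forall>(u, v) \<in> parcs G.
      arc (crv {u, v}) \<and>
      {pathstart (crv {u, v}), pathfinish (crv {u, v})} = {pos u, pos v} \<and>
      (path_image (crv {u, v}) - {pos u, pos v}) \<inter> pos ` pverts G = {} \<and>
      (\<forall>(x, y) \<in> parcs G. {x, y} \<noteq> {u, v} \<longrightarrow>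
        (path_image (crv {u, v}) - {pos u, pos v}) \<inter> path_image (crv {x, y}) = {}))"

definition planar :: "'a pair_pre_digraph \<Rightarrow> bool" where
  "planar G \<longleftrightarrow> (\<exists>pos crv. plane_drawing G pos crv)"

end

theory Submission
  imports Defs
begin

text \<open>
  Write \<open>k = 2 * m + 4\<close>. Take the brick wall on a cylinder with five rings: a ring of \<open>c\<close> vertices
  at either end and three rings of \<open>2 * c\<close> vertices between them, so that the two end faces have
  length \<open>c\<close>, the faces next to them are pentagons and all others are hexagons. Replace every vertex by
  a ladder with \<open>k - 1\<close> vertices and three exits, two of them (left and right) leading along the ring and
  one (vertical) to a neighbouring ring. A cycle inside a ladder has length at most \<open>k - 1\<close>.

  Crossing an untwisted ladder from left to right takes 2 vertices, and between the vertical exit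
  and either side \<open>k / 2\<close> vertices; in a twisted ladder one vertex moves from the right-vertical to the
  left-right crossing. With the twisted ladders placed on the second and fourth ring, a cycle that
  leaves a ladder and whose topmost ring is \<open>i\<close> spends at least \<open>k + i\<close> vertices there, and at least
  \<open>k + 4 - j\<close> in its bottommost ring \<open>j\<close>; if \<open>j > i + 1\<close>, the ring below the top contributes at least
  4 more. Altogether this gives \<open>2 * k + 3\<close>. A cycle that stays in one ring goes all the way
  round, and \<open>c\<close> is chosen large.
\<close>

subsection \<open>Cycles, connectivity and relabelling\<close>

text \<open>By Euler's formula the two end faces, longer than 6, force faces shorter than 6, and
  these pentagons are the obstacle. Without twists the cycle around a pentagon spends
  \<open>k\<close> vertices in its end ring and \<open>k + 2\<close> in the next ring, one too few,
  whereas a hexagon gives \<open>2 * k + 4\<close>, one more than required. Twisting hands this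
  spare vertex from the hexagons to the pentagons.

  The number of rings follows from the same balance. Let \<open>t i\<close> and \<open>b i\<close>
  be the surplus over \<open>k\<close> in ring \<open>i\<close> when it is the topmost or the
  bottommost ring of the cycle. In an end ring no ladder lies between two neighbouring turns, so
  \<open>t 0 = 0\<close>; in an inner ring a twist only shifts vertices between the two cases, so
  \<open>t i + b i = 4\<close>. Asking for \<open>t i + b (i + 1) = 3\<close> then forces
  \<open>t i = i\<close>, and the bottom surplus has dropped to 0, the value of an end ring,
  precisely at ring 4.

  The cycle is never traced through a ladder: which exits it uses is controlled by parity, and the
  vertices it must visit are counted by a distance function.\<close>

lemma cycle_spectrumD:
  assumes "n \<in> cycle_spectrum G"
  obtains v :: "nat \<Rightarrow> 'a" where "3 \<le> n" "inj_on v {..<n}"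
    "\<And>i. i < n \<Longrightarrow> (v i, v (Suc i mod n)) \<in> parcs G"
proof -
  interpret pair_pre_digraph G .
  obtain p u where p: "n = length p" "3 \<le> length p" "awalk u p u"
    "distinct (tl (awalk_verts u p))"
    using assms by (auto simp: cycle_spectrum_def pre_digraph.cycle_def)
  \<comment> \<open>The counting arguments work with an injective function on positions modulo
    \<open>n\<close>; position \<open>i\<close> carries the tail of the \<open>i\<close>-th
    arc.\<close>
  define v where "v = (\<lambda>i. fst (p ! i))"
  have arcs: "set p \<subseteq> parcs G" and cas: "pcas u p u"
    using p(3) by (auto simp: awalk_def)
  have step: "Suc i < length q \<Longrightarrow> pcas x q y \<Longrightarrow> snd (q ! i) = fst (q ! Suc i)" for i q x y
  proof (induction q arbitrary: i x)
    case (Cons e q)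
    then show ?case by (cases i; cases q) auto
  qed simp
  have hdlast: "q \<noteq> [] \<Longrightarrow> pcas x q y \<Longrightarrow> fst (q ! 0) = x \<and> snd (q ! (length q - 1)) = y" for q x y
  proof (induction q arbitrary: x)
    case (Cons e q)
    then show ?case by (cases q) auto
  qed simp
  have ne: "p \<noteq> []" using p by auto
  have nxt: "snd (p ! i) = v (Suc i mod n)" if "i < n" for i
  proof (cases "Suc i < n")
    case True then show ?thesis using step[of i p u u] cas p(1) by (simp add: v_def)
  next
    case False
    then have "i = n - 1" "Suc i = n" using that by auto
    then show ?thesis using hdlast[OF ne cas] p(1) by (simp add: v_def)
  qed
  have "awalk_verts u p = fst (hd p) # map snd p"
    using awalk_verts_conv'[of u p u] ne cas by simp
  then have "distinct (map snd p)" using p(4) by simp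
  then have dist: "inj_on (\<lambda>i. snd (p ! i)) {..<n}"
    using p(1) by (auto simp: inj_on_def distinct_conv_nth)
  have "inj_on v {..<n}"
  proof (rule inj_onI)
    fix i j assume ij: "i \<in> {..<n}" "j \<in> {..<n}" "v i = v j"
    \<comment> \<open>Distinctness of the closed walk concerns the heads of its arcs, whereas
      \<open>v\<close> lists the tails; the cyclic predecessor \<open>pr\<close> translates one into
      the other.\<close>
    define pr where "pr = (\<lambda>i. if i = 0 then n - 1 else i - 1)"
    have pr: "Suc (pr l) mod n = l" "pr l < n" if "l < n" for l
      using that p(1,2) by (auto simp: pr_def)
    have "snd (p ! pr i) = snd (p ! pr j)"
      using nxt[of "pr i"] nxt[of "pr j"] pr ij by auto
    then have "pr i = pr j" using dist pr ij by (auto simp: inj_on_def)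
    then show "i = j" using pr ij by (metis lessThan_iff)
  qed
  moreover have "(v i, v (Suc i mod n)) \<in> parcs G" if "i < n" for i
    using nxt[OF that] arcs nth_mem[of i p] that p(1) by (metis prod.collapse subsetD v_def)
  ultimately show thesis using p that by blast
qed

lemma cycle_spectrumI:
  fixes v :: "nat \<Rightarrow> 'a"
  assumes "pair_wf_digraph G" "3 \<le> n" "inj_on v {..<n}"
    "\<And>i. i < n \<Longrightarrow> (v i, v (Suc i mod n)) \<in> parcs G"
  shows "n \<in> cycle_spectrum G"
proof -
  interpret pair_wf_digraph G by fact
  define p where "p = map (\<lambda>i. (v i, v (Suc i mod n))) [0..<n]"
  have cas: "pcas (f a) (map (\<lambda>i. (f i, f (Suc i))) [a..<b]) (f b)" if "a \<le> b" for a b and f :: "nat \<Rightarrow> 'a"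
    using that by (induction "b - a" arbitrary: a) (auto simp: upt_conv_Cons)
  have p_eq: "p = map (\<lambda>i. ((\<lambda>i. v (i mod n)) i, (\<lambda>i. v (i mod n)) (Suc i))) [0..<n]"
    by (simp add: p_def)
  have c: "pcas (v 0) p (v 0)"
    using cas[of 0 n "\<lambda>i. v (i mod n)"] unfolding p_eq by simp
  have len: "length p = n" by (simp add: p_def)
  have "p \<noteq> []" using len assms by auto
  have v: "awalk_verts (v 0) p = fst (hd p) # map snd p"
    using awalk_verts_conv'[of "v 0" p "v 0"] c \<open>p \<noteq> []\<close> by simp
  have "distinct (map snd p)"
  proof -
    have "i = j" if "i < n" "j < n" "v (Suc i mod n) = v (Suc j mod n)" for i j
    proof -
      have "Suc i mod n = Suc j mod n" using assms(3) that assms(2) by (auto simp: inj_on_def)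
      then show ?thesis using that by (auto simp: mod_Suc split: if_splits)
    qed
    then show ?thesis by (auto simp: p_def distinct_map inj_on_def)
  qed
  moreover have "awalk (v 0) p (v 0)"
    using c assms(2,4) by (auto simp: awalk_def p_def intro: in_arcsD1[OF assms(4)[of 0]])
  ultimately have "cycle p"
    using v \<open>p \<noteq> []\<close> unfolding cycle_def by auto
  then show ?thesis
    using len assms(2) unfolding cycle_spectrum_def by auto
qed

text \<open>\<open>circumference\<close> is a \<open>Max\<close>, which is known to dominate its set
  only when that set is finite.\<close>

lemma finite_cycle_spectrum:
  assumes "pair_fin_digraph G"
  shows "finite (cycle_spectrum G)"
proof (rule finite_subset)
  interpret pair_fin_digraph G by fact
  show "cycle_spectrum G \<subseteq> {..card (pverts G)}"
  proof
    fix n assume "n \<in> cycle_spectrum G"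
    then obtain v :: "nat \<Rightarrow> 'a" where v: "inj_on v {..<n}"
      "\<And>i. i < n \<Longrightarrow> (v i, v (Suc i mod n)) \<in> parcs G"
      by (rule cycle_spectrumD) auto
    have "v ` {..<n} \<subseteq> pverts G" using v(2) in_arcsD1 by blast
    from card_mono[OF pair_finite_verts this] show "n \<in> {..card (pverts G)}"
      using v(1) by (simp add: card_image)
  qed
qed simp

lemma parcs_mk_symmetric_induce:
  "parcs (mk_symmetric (with_proj G \<restriction> W)) =
    {(x, y). x \<in> W \<and> y \<in> W \<and> ((x, y) \<in> parcs G \<or> (y, x) \<in> parcs G)}"
  by (auto simp: mk_symmetric_def induce_subgraph_def)

lemma connected_induceI:
  assumes "W \<noteq> {}" "\<And>u v. u \<in> W \<Longrightarrow> v \<in> W \<Longrightarrow> (u, v) \<in> (parcs G \<inter> W \<times> W)\<^sup>*"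
  shows "Digraph_Component.connected (with_proj G \<restriction> W)"
proof -
  let ?S = "mk_symmetric (with_proj G \<restriction> W)"
  have V: "pverts ?S = W" by (simp add: mk_symmetric_def)
  have A: "parcs G \<inter> W \<times> W \<subseteq> parcs ?S"
    by (auto simp: parcs_mk_symmetric_induce)
  have "(u, v) \<in> rtrancl_on W (parcs ?S)" if "u \<in> W" "v \<in> W" for u v
    using assms(2)[OF that]
  proof (induction rule: rtrancl_induct)
    case base then show ?case using that by simp
  next
    case (step y z) then show ?case using A by (auto intro: rtrancl_on_into_rtrancl_on)
  qed
  then show ?thesis
    using assms(1) by (auto simp: Digraph_Component.connected_def strongly_connected_def reachable_def V)
qed

lemma card_verts_digraph_iso:
  assumes "digraph_iso G H"
  shows "card (verts H) = card (verts G)"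
proof -
  obtain f where "pre_digraph.digraph_isomorphism G f" "H = app_iso f G"
    using assms by (auto simp: digraph_iso_def)
  then show ?thesis
    by (simp add: app_iso_def pre_digraph.digraph_isomorphism_def card_image)
qed

lemma plane_drawingI:
  assumes "inj_on pos (pverts G)"
    and "\<And>u v. (u, v) \<in> parcs G \<Longrightarrow> arc (crv {u, v})"
    and "\<And>u v. (u, v) \<in> parcs G \<Longrightarrow>
      {pathstart (crv {u, v}), pathfinish (crv {u, v})} = {pos u, pos v}"
    and "\<And>u v w. (u, v) \<in> parcs G \<Longrightarrow> w \<in> pverts G \<Longrightarrow>
      pos w \<in> path_image (crv {u, v}) \<Longrightarrow> pos w = pos u \<or> pos w = pos v"
    and "\<And>u v x y z. (u, v) \<in> parcs G \<Longrightarrow> (x, y) \<in> parcs G \<Longrightarrow> {x, y} \<noteq> {u, v} \<Longrightarrow>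
      z \<in> path_image (crv {u, v}) \<Longrightarrow> z \<in> path_image (crv {x, y}) \<Longrightarrow> z = pos u \<or> z = pos v"
  shows "plane_drawing G pos crv"
proof -
  have 1: "(path_image (crv {u, v}) - {pos u, pos v}) \<inter> pos ` pverts G = {}"
    if "(u, v) \<in> parcs G" for u v
    using assms(4)[OF that] by blast
  have 2: "(path_image (crv {u, v}) - {pos u, pos v}) \<inter> path_image (crv {x, y}) = {}"
    if "(u, v) \<in> parcs G" "(x, y) \<in> parcs G" "{x, y} \<noteq> {u, v}" for u v x y
    using assms(5)[OF that] by blast
  show ?thesis
    unfolding plane_drawing_def using assms(1-3) 1 2 by (simp add: split_beta)
qed

section \<open>Invariance under injective renaming of vertices\<close>

definition relabel :: "('a \<Rightarrow> 'b) \<Rightarrow> 'a pair_pre_digraph \<Rightarrow> 'b pair_pre_digraph" where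
  "relabel f G = \<lparr>pverts = f ` pverts G, parcs = map_prod f f ` parcs G\<rparr>"

lemma relabel_simps [simp]:
  "pverts (relabel f G) = f ` pverts G" "parcs (relabel f G) = map_prod f f ` parcs G"
  by (simp_all add: relabel_def)

context
  fixes f :: "'a \<Rightarrow> 'b" and G :: "'a pair_pre_digraph"
  assumes f: "inj f"
begin

lemma relabel_arc_iff: "(f u, f v) \<in> parcs (relabel f G) \<longleftrightarrow> (u, v) \<in> parcs G"
  using f by (auto simp: inj_def)

lemma pair_graph_relabel:
  assumes "pair_graph G" shows "pair_graph (relabel f G)"
proof -
  interpret pair_graph G by fact
  show ?thesis
  proof
    show "symmetric (with_proj (relabel f G))"
      using pair_sym_arcs by (force simp: symmetric_def sym_def)
  next
    fix e assume "e \<in> parcs (relabel f G)"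
    then show "fst e \<noteq> snd e" using f pair_no_loops by (auto simp: inj_eq)
  qed (use pair_finite_verts pair_finite_arcs in \<open>auto dest: in_arcsD1 in_arcsD2\<close>)
qed

lemma cubic_relabel:
  assumes "cubic G" shows "cubic (relabel f G)"
proof -
  have "out_arcs (with_proj (relabel f G)) (f v) = map_prod f f ` out_arcs (with_proj G) v" for v
    using f by (auto simp: out_arcs_def inj_eq)
  moreover have "inj (map_prod f f)" using f by (rule prod.inj_map) (rule f)
  ultimately show ?thesis
    using assms by (auto simp: cubic_def out_degree_def card_image inj_on_subset)
qed

lemma cycle_spectrum_relabel: "cycle_spectrum (relabel f G) \<subseteq> cycle_spectrum G"
  if "pair_graph G"
proof
  interpret pair_graph G by fact
  fix n assume "n \<in> cycle_spectrum (relabel f G)"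
  then obtain v :: "nat \<Rightarrow> 'b" where v: "3 \<le> n" "inj_on v {..<n}"
      "\<And>i. i < n \<Longrightarrow> (v i, v (Suc i mod n)) \<in> parcs (relabel f G)"
    by (rule cycle_spectrumD) auto
  define w where "w = inv f \<circ> v"
  have fw: "v i = f (w i)" if "i < n" for i
    using v(3)[OF that] f by (auto simp: w_def)
  show "n \<in> cycle_spectrum G"
  proof (rule cycle_spectrumI)
    show "inj_on w {..<n}" using v(2) fw by (auto simp: inj_on_def)
    show "(w i, w (Suc i mod n)) \<in> parcs G" if "i < n" for i
      using v(3)[OF that] fw[OF that] fw[of "Suc i mod n"] v(1) relabel_arc_iff by simp
  qed (use v in \<open>auto intro: pair_wf_digraph_axioms\<close>)
qed

lemma cycle_spectrum_relabel_supset: "cycle_spectrum G \<subseteq> cycle_spectrum (relabel f G)"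
  if "pair_graph G"
proof
  interpret R: pair_graph "relabel f G" by (rule pair_graph_relabel) fact
  fix n assume "n \<in> cycle_spectrum G"
  then obtain v :: "nat \<Rightarrow> 'a" where v: "3 \<le> n" "inj_on v {..<n}"
      "\<And>i. i < n \<Longrightarrow> (v i, v (Suc i mod n)) \<in> parcs G"
    by (rule cycle_spectrumD) auto
  show "n \<in> cycle_spectrum (relabel f G)"
  proof (rule cycle_spectrumI)
    show "inj_on (f \<circ> v) {..<n}" using v(2) f by (simp add: comp_inj_on inj_on_subset)
    show "((f \<circ> v) i, (f \<circ> v) (Suc i mod n)) \<in> parcs (relabel f G)" if "i < n" for i
      using v(3)[OF that] by (simp only: relabel_arc_iff o_apply)
  qed (use v in \<open>auto intro: R.pair_wf_digraph_axioms\<close>)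
qed

lemma vertex_connected_relabel:
  assumes "vertex_connected n G" shows "vertex_connected n (relabel f G)"
  unfolding vertex_connected_def
proof (intro conjI allI impI)
  show "n < card (pverts (relabel f G))"
    using assms f by (simp add: vertex_connected_def card_image inj_on_subset)
  fix X assume X: "X \<subseteq> pverts (relabel f G)" "card X < n"
  define Y where "Y = f -` X"
  have XY: "X = f ` Y" using X by (auto simp: Y_def)
  let ?W = "pverts G - Y"
  have W: "pverts (relabel f G) - X = f ` ?W"
    using f by (auto simp: XY inj_eq)
  have "Y \<subseteq> pverts G" using X f by (auto simp: Y_def inj_eq)
  moreover have "card Y = card X" using f by (simp add: XY card_image inj_on_subset)
  ultimately have conn: "Digraph_Component.connected (with_proj G \<restriction> ?W)"
    using assms X by (simp add: vertex_connected_def)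
  let ?S = "mk_symmetric (with_proj G \<restriction> ?W)" and ?T = "mk_symmetric (with_proj (relabel f G) \<restriction> f ` ?W)"
  have V: "pverts ?S = ?W" "pverts ?T = f ` ?W" by (auto simp: mk_symmetric_def)
  have A: "(f x, f y) \<in> parcs ?T" if "(x, y) \<in> parcs ?S" for x y
    using that by (auto simp: parcs_mk_symmetric_induce relabel_arc_iff simp del: relabel_simps)
  have "(f u, f v) \<in> rtrancl_on (f ` ?W) (parcs ?T)" if "(u, v) \<in> rtrancl_on ?W (parcs ?S)" for u v
    using that by (induction rule: rtrancl_on.induct)
     (auto intro: rtrancl_on_into_rtrancl_on A)
  then show "Digraph_Component.connected (with_proj (relabel f G) \<restriction> (pverts (relabel f G) - X))"
    using conn unfolding W
    by (auto simp: Digraph_Component.connected_def strongly_connected_def reachable_def V)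
qed

lemma planar_relabel:
  assumes "planar G" shows "planar (relabel f G)"
proof -
  obtain pos crv where d: "plane_drawing G pos crv" using assms by (auto simp: planar_def)
  define g where "g = inv f"
  have g: "g (f x) = x" for x using f by (simp add: g_def)
  have im: "g ` {f x, f y} = {x, y}" for x y by (simp add: g)
  have eq: "{f x, f y} = {f u, f v} \<longleftrightarrow> {x, y} = {u, v}" for x y u v
  proof
    assume "{f x, f y} = {f u, f v}"
    then show "{x, y} = {u, v}" using im[of x y] im[of u v] by simp
  next
    assume "{x, y} = {u, v}"
    then have "f ` {x, y} = f ` {u, v}" by simp
    then show "{f x, f y} = {f u, f v}" by simp
  qed
  have pos: "(pos \<circ> g) ` pverts (relabel f G) = pos ` pverts G" by (force simp: g image_iff)
  \<comment> \<open>A curve is addressed by its set of ends, so the old curve is found under the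
    image of that set.\<close>
  let ?c = "crv \<circ> (`) g"
  have inj: "inj_on pos (pverts G)"
    and arcs: "\<And>u v. (u, v) \<in> parcs G \<Longrightarrow> arc (crv {u, v}) \<and>
      {pathstart (crv {u, v}), pathfinish (crv {u, v})} = {pos u, pos v} \<and>
      (path_image (crv {u, v}) - {pos u, pos v}) \<inter> pos ` pverts G = {}"
    and disj: "\<And>u v x y. (u, v) \<in> parcs G \<Longrightarrow> (x, y) \<in> parcs G \<Longrightarrow> {x, y} \<noteq> {u, v} \<Longrightarrow>
      (path_image (crv {u, v}) - {pos u, pos v}) \<inter> path_image (crv {x, y}) = {}"
    using d unfolding plane_drawing_def by blast+
  have c: "?c {f u, f v} = crv {u, v}" for u v by (simp add: g)
  have arcE: "\<exists>x' y'. (x', y') \<in> parcs G \<and> x = f x' \<and> y = f y'"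
    if "(x, y) \<in> parcs (relabel f G)" for x y
    using that by auto
  have "plane_drawing (relabel f G) (pos \<circ> g) ?c"
  proof (rule plane_drawingI)
    show "inj_on (pos \<circ> g) (pverts (relabel f G))"
      using inj by (auto simp: inj_on_def g)
  next
    fix u v assume "(u, v) \<in> parcs (relabel f G)"
    then obtain u' v' where uv: "(u', v') \<in> parcs G" "u = f u'" "v = f v'" using arcE by blast
    show "arc (?c {u, v})" unfolding uv c using arcs[OF uv(1)] by blast
    show "{pathstart (?c {u, v}), pathfinish (?c {u, v})} = {(pos \<circ> g) u, (pos \<circ> g) v}"
      unfolding uv c using arcs[OF uv(1)] by (simp add: g)
    fix w assume w: "w \<in> pverts (relabel f G)" "(pos \<circ> g) w \<in> path_image (?c {u, v})"
    then obtain w' where w': "w = f w'" "w' \<in> pverts G" by auto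
    have "pos w' \<in> path_image (crv {u', v'})" using w(2) unfolding uv c w' by (simp add: g)
    then have "pos w' = pos u' \<or> pos w' = pos v'" using arcs[OF uv(1)] w' by blast
    then show "(pos \<circ> g) w = (pos \<circ> g) u \<or> (pos \<circ> g) w = (pos \<circ> g) v"
      by (simp add: uv w' g)
  next
    fix u v x y z
    assume a: "(u, v) \<in> parcs (relabel f G)" "(x, y) \<in> parcs (relabel f G)" "{x, y} \<noteq> {u, v}"
      "z \<in> path_image (?c {u, v})" "z \<in> path_image (?c {x, y})"
    obtain u' v' where uv: "(u', v') \<in> parcs G" "u = f u'" "v = f v'" using arcE[OF a(1)] by blast
    obtain x' y' where xy: "(x', y') \<in> parcs G" "x = f x'" "y = f y'" using arcE[OF a(2)] by blast
    have "{x', y'} \<noteq> {u', v'}" using a(3) eq unfolding uv xy by blast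
    moreover have "z \<in> path_image (crv {u', v'})" "z \<in> path_image (crv {x', y'})"
      using a(4,5) unfolding uv xy c by auto
    ultimately have "z = pos u' \<or> z = pos v'" using disj[OF uv(1) xy(1)] by blast
    then show "z = (pos \<circ> g) u \<or> z = (pos \<circ> g) v" by (simp add: uv g)
  qed
  then show ?thesis by (auto simp: planar_def)
qed

end

subsection \<open>The wall of ladders\<close>

text \<open>
  The triple \<open>(r, s, a)\<close> is vertex number \<open>a\<close> of the ladder in ring \<open>r\<close> and angular slot \<open>s\<close>. The rings 0
  and 4 only occupy the even and the odd slots, respectively. A ladder is stored as a Hamiltonian cycle
  \<open>0, \<dots>, 2 * m + 2\<close> together with chords; its exits are 0 (vertical), \<open>m + 1\<close> (left) and
  \<open>m + 2 + twist r s\<close> (right), where \<open>twist r s = 1\<close> marks a twisted ladder. The third neighbour of a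
  vertex, which is not next to it on the Hamiltonian cycle, is its \<open>mate\<close>.
\<close>

locale ladder_wall =
  fixes m c :: nat
  assumes m_pos: "1 \<le> m" and c_ge: "3 \<le> c"
begin

abbreviation M :: nat where "M \<equiv> 2 * m + 3"

definition block :: "nat \<Rightarrow> nat \<Rightarrow> bool" where
  "block r s \<longleftrightarrow> r \<le> 4 \<and> s < 2 * c \<and> (r = 0 \<longrightarrow> even s) \<and> (r = 4 \<longrightarrow> odd s)"

definition stride :: "nat \<Rightarrow> nat" where
  "stride r = (if r = 0 \<or> r = 4 then 2 else 1)"

definition rnext :: "nat \<Rightarrow> nat \<Rightarrow> nat" where
  "rnext r s = (if s + stride r < 2 * c then s + stride r else s + stride r - 2 * c)"

definition rprev :: "nat \<Rightarrow> nat \<Rightarrow> nat" where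
  "rprev r s = (if stride r \<le> s then s - stride r else s + 2 * c - stride r)"

text \<open>The parity of \<open>r + s\<close> alternates along an inner ring, which gives the brick
  pattern. In rings 0 and 4 \<open>block\<close> keeps just the slots whose link stays within the
  five rings, so \<open>r - 1\<close> is never truncated there.\<close>

definition vlink :: "nat \<Rightarrow> nat \<Rightarrow> nat" where
  "vlink r s = (if even (r + s) then r + 1 else r - 1)"

text \<open>Twisted are the ladders of rings 1 and 3 whose vertical exit leads to the middle ring. A
  pentagon passes such a ladder from left to right and gains a vertex; a hexagon turns in it and may
  lose one.\<close>

definition twist :: "nat \<Rightarrow> nat \<Rightarrow> nat" where
  "twist r s = (if r = 1 \<and> odd s \<or> r = 3 \<and> even s then 1 else 0)"

text \<open>The rungs of the ladder join \<open>a\<close> and \<open>2 * m + 3 - a\<close>. In a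
  twisted ladder \<open>m + 3\<close> is an exit in place of \<open>m + 2\<close>, so
  \<open>m\<close> gets \<open>m + 2\<close> as its partner.\<close>

definition chord :: "nat \<Rightarrow> nat \<Rightarrow> nat" where
  "chord d a = (if d = 1 \<and> (a = m \<or> a = m + 2) then 2 * m + 2 - a else 2 * m + 3 - a)"

definition csucc :: "nat \<Rightarrow> nat" where
  "csucc a = (if a = 2 * m + 2 then 0 else a + 1)"

definition cpred :: "nat \<Rightarrow> nat" where
  "cpred a = (if a = 0 then 2 * m + 2 else a - 1)"

definition mate :: "nat \<Rightarrow> nat \<Rightarrow> nat \<Rightarrow> nat \<times> nat \<times> nat" where
  "mate r s a =
    (if a = 0 then (vlink r s, s, 0)
     else if a = m + 1 then (r, rprev r s, m + 2 + twist r (rprev r s))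
     else if a = m + 2 + twist r s then (r, rnext r s, m + 1)
     else (r, s, chord (twist r s) a))"

definition V :: "(nat \<times> nat \<times> nat) set" where
  "V = {(r, s, a). block r s \<and> a < M}"

definition nbrs :: "nat \<times> nat \<times> nat \<Rightarrow> (nat \<times> nat \<times> nat) set" where
  "nbrs = (\<lambda>(r, s, a). {(r, s, csucc a), (r, s, cpred a), mate r s a})"

definition wall :: "(nat \<times> nat \<times> nat) pair_pre_digraph" where
  "wall = \<lparr>pverts = V, parcs = {(x, y). x \<in> V \<and> y \<in> nbrs x}\<rparr>"

lemma twist_le: "twist r s \<le> 1" by (simp add: twist_def)

lemma block_rnext: "block r s \<Longrightarrow> block r (rnext r s)"
  using c_ge by (auto simp: block_def rnext_def stride_def split: if_splits)

lemma block_rprev: "block r s \<Longrightarrow> block r (rprev r s)"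
  using c_ge by (auto simp: block_def rprev_def stride_def split: if_splits)

lemma rprev_rnext: "block r s \<Longrightarrow> rprev r (rnext r s) = s"
  using c_ge by (auto simp: block_def rprev_def rnext_def stride_def split: if_splits)

lemma rnext_rprev: "block r s \<Longrightarrow> rnext r (rprev r s) = s"
  using c_ge by (auto simp: block_def rprev_def rnext_def stride_def split: if_splits)

lemma rnext_neq: "block r s \<Longrightarrow> rnext r s \<noteq> s"
  using c_ge by (auto simp: block_def rnext_def stride_def split: if_splits)

lemma rprev_neq: "block r s \<Longrightarrow> rprev r s \<noteq> s"
  using c_ge by (auto simp: block_def rprev_def stride_def split: if_splits)

lemma block_vlink:
  assumes "block r s" shows "block (vlink r s) s"
proof -
  consider "r = 0" | "r = 1" | "r = 2" | "r = 3" | "r = 4" using assms by (force simp: block_def)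
  then show ?thesis using assms by cases (auto simp: block_def vlink_def)
qed

lemma vlink_vlink:
  assumes "block r s" shows "vlink (vlink r s) s = r"
proof -
  consider "r = 0" | "r = 1" | "r = 2" | "r = 3" | "r = 4" using assms by (force simp: block_def)
  then show ?thesis using assms by cases (auto simp: block_def vlink_def)
qed

lemma vlink_neq: "block r s \<Longrightarrow> vlink r s \<noteq> r"
  by (cases "r = 0") (auto simp: block_def vlink_def)

lemma csucc_cpred [simp]: "a < M \<Longrightarrow> csucc (cpred a) = a" "a < M \<Longrightarrow> cpred (csucc a) = a"
  and csucc_less [simp]: "a < M \<Longrightarrow> csucc a < M" and cpred_less [simp]: "a < M \<Longrightarrow> cpred a < M"
  by (auto simp: csucc_def cpred_def)

lemma csucc_neq: "a < M \<Longrightarrow> csucc a \<noteq> a \<and> cpred a \<noteq> a \<and> csucc a \<noteq> cpred a"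
  using m_pos by (auto simp: csucc_def cpred_def)

lemma chord_props:
  assumes "d \<le> 1" "a < M" "a \<noteq> 0" "a \<noteq> m + 1" "a \<noteq> m + 2 + d"
  shows "chord d a < M" "chord d a \<noteq> 0" "chord d a \<noteq> m + 1" "chord d a \<noteq> m + 2 + d"
    "chord d (chord d a) = a" "chord d a \<noteq> a" "chord d a \<noteq> csucc a" "chord d a \<noteq> cpred a"
  using assms m_pos by (auto simp: chord_def csucc_def cpred_def split: if_splits)

text \<open>That \<open>mate\<close> is an involution makes adjacency symmetric; the inequalities
  exclude loops and keep the three neighbours of a vertex distinct.\<close>

lemma mate_props:
  assumes "block r s" "a < M" "mate r s a = (r', s', a')"
  shows "block r' s'" "a' < M" "mate r' s' a' = (r, s, a)" "(r', s', a') \<noteq> (r, s, a)"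
    "(r', s', a') \<noteq> (r, s, csucc a)" "(r', s', a') \<noteq> (r, s, cpred a)"
proof -
  consider (v) "a = 0" | (l) "a = m + 1" | (r) "a = m + 2 + twist r s"
    | (c) "a \<noteq> 0" "a \<noteq> m + 1" "a \<noteq> m + 2 + twist r s" by blast
  then have "block r' s' \<and> a' < M \<and> mate r' s' a' = (r, s, a) \<and> (r', s', a') \<noteq> (r, s, a) \<and>
    (r', s', a') \<noteq> (r, s, csucc a) \<and> (r', s', a') \<noteq> (r, s, cpred a)"
  proof cases
    case v
    then show ?thesis using assms block_vlink vlink_vlink vlink_neq by (auto simp: mate_def)
  next
    case l
    then have "r' = r" "s' = rprev r s" "a' = m + 2 + twist r s'" using assms by (auto simp: mate_def)
    then show ?thesis using assms l block_rprev rnext_rprev rprev_neq twist_le[of r s'] m_pos by (auto simp: mate_def)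
  next
    case r
    then have "r' = r" "s' = rnext r s" "a' = m + 1" using assms by (auto simp: mate_def)
    then show ?thesis using assms r block_rnext rprev_rnext rnext_neq by (auto simp: mate_def)
  next
    case c
    then have "r' = r" "s' = s" "a' = chord (twist r s) a" using assms by (auto simp: mate_def)
    then show ?thesis using assms c chord_props[OF twist_le assms(2) c] by (auto simp: mate_def)
  qed
  then show "block r' s'" "a' < M" "mate r' s' a' = (r, s, a)" "(r', s', a') \<noteq> (r, s, a)"
    "(r', s', a') \<noteq> (r, s, csucc a)" "(r', s', a') \<noteq> (r, s, cpred a)" by blast+
qed

lemma in_V [simp]: "(r, s, a) \<in> V \<longleftrightarrow> block r s \<and> a < M"
  by (simp add: V_def)

lemma nbrs_V: "x \<in> V \<Longrightarrow> nbrs x \<subseteq> V"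
proof -
  assume "x \<in> V"
  then obtain r s a where x: "x = (r, s, a)" "block r s" "a < M" by (auto simp: V_def)
  obtain r' s' a' where mt: "mate r s a = (r', s', a')" by (metis prod_cases3)
  show ?thesis using mate_props(1,2)[OF x(2,3) mt] x mt by (simp add: nbrs_def)
qed

lemma nbrs_sym: "x \<in> V \<Longrightarrow> y \<in> nbrs x \<Longrightarrow> x \<in> nbrs y"
proof -
  assume "x \<in> V" "y \<in> nbrs x"
  then obtain r s a where x: "x = (r, s, a)" "block r s" "a < M" by (auto simp: V_def)
  obtain r' s' a' where mt: "mate r s a = (r', s', a')" by (metis prod_cases3)
  from \<open>y \<in> nbrs x\<close> consider "y = (r, s, csucc a)" | "y = (r, s, cpred a)" | "y = (r', s', a')"
    by (auto simp: nbrs_def x mt)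
  then show ?thesis
    by cases (use mate_props(3)[OF x(2,3) mt] x in \<open>simp_all add: nbrs_def\<close>)
qed

lemma nbrs_irrefl: "x \<in> V \<Longrightarrow> x \<notin> nbrs x"
proof -
  assume "x \<in> V"
  then obtain r s a where x: "x = (r, s, a)" "block r s" "a < M" by (auto simp: V_def)
  obtain r' s' a' where mt: "mate r s a = (r', s', a')" by (metis prod_cases3)
  show ?thesis using mate_props(4)[OF x(2,3) mt] csucc_neq[OF x(3)] x mt by (auto simp: nbrs_def)
qed

lemma card_nbrs: "x \<in> V \<Longrightarrow> card (nbrs x) = 3"
proof -
  assume "x \<in> V"
  then obtain r s a where x: "x = (r, s, a)" "block r s" "a < M" by (auto simp: V_def)
  obtain r' s' a' where mt: "mate r s a = (r', s', a')" by (metis prod_cases3)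
  show ?thesis
    using mate_props(5,6)[OF x(2,3) mt] csucc_neq[OF x(3)] x mt by (auto simp: nbrs_def)
qed

lemma wall_simps [simp]: "pverts wall = V" "(x, y) \<in> parcs wall \<longleftrightarrow> x \<in> V \<and> y \<in> nbrs x"
  by (auto simp: wall_def)

lemma finite_V: "finite V"
proof (rule finite_subset)
  show "V \<subseteq> {..4} \<times> {..<2 * c} \<times> {..<M}" by (auto simp: V_def block_def)
qed simp

lemma nbr_in_V: "x \<in> V \<Longrightarrow> y \<in> nbrs x \<Longrightarrow> y \<in> V"
  using nbrs_V by blast

lemma pair_graph_wall: "pair_graph wall"
proof
  show "finite (parcs wall)"
  proof (rule finite_subset)
    show "parcs wall \<subseteq> V \<times> V"
    proof (rule subrelI)
      fix x y assume "(x, y) \<in> parcs wall"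
      then show "(x, y) \<in> V \<times> V" using nbr_in_V[of x y] by simp
    qed
  qed (simp add: finite_V)
  have "(y, x) \<in> parcs wall" if "(x, y) \<in> parcs wall" for x y
    using that nbrs_sym[of x y] nbr_in_V[of x y] by simp
  then show "symmetric (with_proj wall)"
    unfolding symmetric_def with_proj_simps by (intro symI)
  fix e assume "e \<in> parcs wall"
  then obtain x y where e: "e = (x, y)" "x \<in> V" "y \<in> nbrs x" by (auto simp: wall_def)
  show "fst e \<in> pverts wall" using e by simp
  show "snd e \<in> pverts wall" using nbr_in_V[OF e(2,3)] e by simp
  show "fst e \<noteq> snd e" using nbrs_irrefl[OF e(2)] e by auto
qed (simp add: finite_V)

lemma cubic_wall: "cubic wall"
proof -
  have "out_arcs (with_proj wall) x = Pair x ` nbrs x" if "x \<in> V" for x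
    using that by (auto simp: out_arcs_def)
  then show ?thesis
    by (auto simp: cubic_def out_degree_def card_image inj_on_def card_nbrs)
qed

end

subsection \<open>Cycle lengths\<close>

lemma even_card_changes:
  fixes b :: "nat \<Rightarrow> bool"
  shows "even (card {i. i < n \<and> b i \<noteq> b (Suc i)}) \<longleftrightarrow> b 0 = b n"
proof (induction n)
  case (Suc n)
  have "{i. i < Suc n \<and> b i \<noteq> b (Suc i)} =
    (if b n \<noteq> b (Suc n) then insert n {i. i < n \<and> b i \<noteq> b (Suc i)} else {i. i < n \<and> b i \<noteq> b (Suc i)})"
    by (auto simp: less_Suc_eq)
  then show ?case using Suc by auto
qed simp

section \<open>Cyclic sequences and the parity of boundary crossings\<close>

locale cyclic_sequence =
  fixes n :: nat and v :: "nat \<Rightarrow> 'a"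
  assumes n_ge: "3 \<le> n" and inj_v: "inj_on v {..<n}"
begin

definition nxt :: "nat \<Rightarrow> 'a" where "nxt i = v (Suc i mod n)"

definition uses :: "'a \<Rightarrow> 'a \<Rightarrow> bool" where
  "uses x y \<longleftrightarrow> (\<exists>i<n. v i = x \<and> nxt i = y \<or> v i = y \<and> nxt i = x)"

lemma uses_sym: "uses x y \<longleftrightarrow> uses y x"
  by (auto simp: uses_def)

lemma v_eq_iff: "i < n \<Longrightarrow> j < n \<Longrightarrow> v i = v j \<longleftrightarrow> i = j"
  using inj_v by (auto simp: inj_on_def)

lemma nxt_in: "nxt i \<in> v ` {..<n}"
  using n_ge by (auto simp: nxt_def)

lemma uses_in:
  assumes "uses x y" shows "x \<in> v ` {..<n}" "y \<in> v ` {..<n}"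
  using assms nxt_in by (auto simp: uses_def)

text \<open>A cyclic sequence enters a set as often as it leaves it.\<close>

lemma even_boundary:
  assumes out: "\<And>i. i < n \<Longrightarrow> v i \<in> P \<Longrightarrow> nxt i \<notin> P \<Longrightarrow> nxt i = mt (v i)"
    and inn: "\<And>i. i < n \<Longrightarrow> v i \<notin> P \<Longrightarrow> nxt i \<in> P \<Longrightarrow> v i = mt (nxt i)"
  shows "even (card {x \<in> P. mt x \<notin> P \<and> uses x (mt x)})"
proof -
  let ?I = "{i. i < n \<and> (v i \<in> P) \<noteq> (nxt i \<in> P)}"
  \<comment> \<open>Each crossing is represented by its end inside \<open>P\<close>, which turns a
    count of steps into a count of vertices.\<close>
  define g where "g i = (if v i \<in> P then v i else nxt i)" for i
  have "even (card {i. i < n \<and> (v (i mod n) \<in> P) \<noteq> (v (Suc i mod n) \<in> P)})"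
    using even_card_changes[of n "\<lambda>i. v (i mod n) \<in> P"] by simp
  also have "{i. i < n \<and> (v (i mod n) \<in> P) \<noteq> (v (Suc i mod n) \<in> P)} = ?I"
    by (auto simp: nxt_def)
  finally have ev: "even (card ?I)" .
  \<comment> \<open>This is where \<open>3 \<le> n\<close> matters: a closed sequence of two
    vertices would run along the same edge in both directions, and \<open>g\<close> would not be
    injective.\<close>
  have flip: False if "i < n" "j < n" "v i = nxt j" "nxt i = v j" for i j
  proof -
    have "i = Suc j mod n" "j = Suc i mod n"
      using that v_eq_iff[of i "Suc j mod n"] v_eq_iff[of j "Suc i mod n"] n_ge
      by (auto simp: nxt_def)
    moreover have "Suc l mod n = (if Suc l = n then 0 else Suc l)" if "l < n" for l
      using that by (simp add: mod_Suc)
    ultimately show False using that n_ge by (auto split: if_splits)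
  qed
  have nxt_inj: "i = j" if "i < n" "j < n" "nxt i = nxt j" for i j
  proof -
    have "Suc i mod n = Suc j mod n"
      using that v_eq_iff[of "Suc i mod n" "Suc j mod n"] n_ge by (simp add: nxt_def)
    then show ?thesis using that by (auto simp: mod_Suc split: if_splits)
  qed
  have "inj_on g ?I"
  proof (rule inj_onI)
    fix i j assume ij: "i \<in> ?I" "j \<in> ?I" and eq: "g i = g j"
    consider "v i \<in> P" "v j \<in> P" | "v i \<notin> P" "v j \<notin> P" | "v i \<in> P" "v j \<notin> P" | "v i \<notin> P" "v j \<in> P"
      by blast
    then show "i = j"
    proof cases
      case 1 then show ?thesis using eq ij v_eq_iff by (auto simp: g_def)
    next
      case 2 then show ?thesis using eq ij nxt_inj by (auto simp: g_def)
    next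
      case 3
      then have "v i = nxt j" "nxt i = v j" using eq ij out[of i] inn[of j] by (auto simp: g_def)
      then show ?thesis using flip ij by blast
    next
      case 4
      then have "v j = nxt i" "nxt j = v i" using eq ij out[of j] inn[of i] by (auto simp: g_def)
      then show ?thesis using flip ij by blast
    qed
  qed
  moreover have "g ` ?I = {x \<in> P. mt x \<notin> P \<and> uses x (mt x)}"
  proof (intro subset_antisym subsetI)
    fix x assume "x \<in> g ` ?I"
    then obtain i where i: "i < n" "(v i \<in> P) \<noteq> (nxt i \<in> P)" "x = g i" by auto
    then show "x \<in> {x \<in> P. mt x \<notin> P \<and> uses x (mt x)}"
      using out[of i] inn[of i] unfolding uses_def g_def by (cases "v i \<in> P") force+
  next
    fix x assume x: "x \<in> {x \<in> P. mt x \<notin> P \<and> uses x (mt x)}"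
    then obtain i where "i < n" "v i = x \<and> nxt i = mt x \<or> v i = mt x \<and> nxt i = x"
      by (auto simp: uses_def)
    then show "x \<in> g ` ?I" using x by (intro image_eqI[of _ _ i]) (auto simp: g_def)
  qed
  ultimately have "bij_betw g ?I {x \<in> P. mt x \<notin> P \<and> uses x (mt x)}"
    by (rule bij_betw_imageI)
  from bij_betw_same_card[OF this] show ?thesis using ev by simp
qed

lemma no_exit_imp_inside:
  assumes "i < n" "v i \<in> P" "\<And>j. j < n \<Longrightarrow> v j \<in> P \<Longrightarrow> nxt j \<in> P"
  shows "v ` {..<n} \<subseteq> P"
proof -
  have all: "v ((i + j) mod n) \<in> P" for j
  proof (induction j)
    case (Suc j)
    then show ?case using assms(3)[of "(i + j) mod n"] n_ge by (simp add: nxt_def mod_Suc_eq)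
  qed (use assms in simp)
  have "v j \<in> P" if "j < n" for j
  proof -
    have "(i + (n - i + j)) mod n = j" using assms(1) that by simp
    then show ?thesis using all[of "n - i + j"] by simp
  qed
  then show ?thesis by auto
qed

end

context ladder_wall
begin

lemma nbrs_same_block:
  assumes "block r s" "a < M" "(r, s, b) \<in> nbrs (r, s, a)"
  shows "b = csucc a \<or> b = cpred a \<or>
    (a \<noteq> 0 \<and> a \<noteq> m + 1 \<and> a \<noteq> m + 2 + twist r s \<and> b = chord (twist r s) a)"
  using assms rnext_neq[OF assms(1)] rprev_neq[OF assms(1)] vlink_neq[OF assms(1)]
  by (auto simp: nbrs_def mate_def split: if_splits)

lemma nbrs_other_block:
  assumes "y \<in> nbrs (r, s, a)" "y = (r', s', b)" "(r', s') \<noteq> (r, s)"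
  shows "y = mate r s a" "a = 0 \<or> a = m + 1 \<or> a = m + 2 + twist r s"
  using assms by (auto simp: nbrs_def mate_def split: if_splits)

text \<open>The distance from the vertical exit \<open>0\<close> within the ladder: chords join
  equal or consecutive levels and therefore give no shortcut.\<close>

definition level :: "nat \<Rightarrow> nat" where "level a = min a (M - a)"

lemma level_lipschitz:
  assumes "block r s" "a < M" "(r, s, b) \<in> nbrs (r, s, a)"
  shows "level b \<le> level a + 1"
  using nbrs_same_block[OF assms] twist_le[of r s] assms(2)
  by (auto simp: level_def csucc_def cpred_def chord_def split: if_splits)

end

section \<open>The exits used by a cycle and the vertices they cost in each ladder\<close>

locale wall_cycle = ladder_wall + cyclic_sequence n v for n and v :: "nat \<Rightarrow> nat \<times> nat \<times> nat" +
  assumes arc_v: "\<And>i. i < n \<Longrightarrow> (v i, v (Suc i mod n)) \<in> parcs wall"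
begin

abbreviation S where "S \<equiv> v ` {..<n}"

definition F :: "nat \<Rightarrow> nat \<Rightarrow> nat set" where "F r s = {a. (r, s, a) \<in> S}"

definition use :: "nat \<Rightarrow> nat \<Rightarrow> nat \<Rightarrow> bool" where
  "use r s a \<longleftrightarrow> uses (r, s, a) (mate r s a)"

lemma card_S: "card S = n" using inj_v by (simp add: card_image)

lemma v_in: "i < n \<Longrightarrow> v i \<in> V" using arc_v[of i] by simp

lemma S_V: "S \<subseteq> V" using v_in by blast

lemma nxt_nbr: "i < n \<Longrightarrow> nxt i \<in> nbrs (v i)" using arc_v[of i] by (simp add: nxt_def)

lemma F_less: "a \<in> F r s \<Longrightarrow> a < M" "a \<in> F r s \<Longrightarrow> block r s"
  using S_V in_V[of r s a] by (auto simp: F_def simp del: in_V)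

lemma finite_F: "finite (F r s)"
  by (rule finite_subset[of _ "{..<M}"]) (use F_less in auto)

lemma use_in_F: "use r s a \<Longrightarrow> a \<in> F r s"
  using uses_in(1) by (auto simp: use_def F_def)

lemma v_nbr_nxt: "i < n \<Longrightarrow> v i \<in> nbrs (nxt i)"
  using nxt_nbr v_in nbrs_sym by blast

text \<open>\<open>cl\<close> says that no visited vertex of the ladder outside \<open>A\<close> is
  adjacent to \<open>A\<close>. The cycle can therefore leave \<open>A\<close> only by leaving the
  ladder, and it crosses the boundary of \<open>A\<close> an even number of times.\<close>

lemma even_exits:
  assumes A: "A \<subseteq> F r s"
    and cl: "\<And>a b. a \<in> A \<Longrightarrow> b \<in> F r s \<Longrightarrow> (r, s, b) \<in> nbrs (r, s, a) \<Longrightarrow> b \<in> A"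
  shows "even (card {a \<in> A. (a = 0 \<or> a = m + 1 \<or> a = m + 2 + twist r s) \<and> use r s a})"
proof -
  let ?P = "(\<lambda>a. (r, s, a)) ` A"
  let ?mt = "\<lambda>(r, s, a). mate r s a"
  have *: "y = ?mt x" if xy: "x \<in> ?P" "y \<notin> ?P" "y \<in> nbrs x" "y \<in> S" for x y
  proof -
    obtain a where a: "x = (r, s, a)" "a \<in> A" using xy by auto
    obtain r' s' b where y: "y = (r', s', b)" by (metis prod_cases3)
    show ?thesis
    proof (cases "(r', s') = (r, s)")
      case True
      then have "b \<in> A" using cl[OF a(2), of b] xy a y by (auto simp: F_def)
      then show ?thesis using xy y True by auto
    next
      case False
      then show ?thesis using nbrs_other_block(1)[of y r s a r' s' b] xy a y by auto
    qed
  qed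
  have "even (card {x \<in> ?P. ?mt x \<notin> ?P \<and> uses x (?mt x)})"
  proof (rule even_boundary)
    fix i assume "i < n" "v i \<in> ?P" "nxt i \<notin> ?P"
    then show "nxt i = ?mt (v i)" using *[of "v i" "nxt i"] nxt_nbr nxt_in by blast
  next
    fix i assume i: "i < n" "v i \<notin> ?P" "nxt i \<in> ?P"
    then have "v i \<in> S" by blast
    then show "v i = ?mt (nxt i)" using *[OF i(3,2)] v_nbr_nxt[OF i(1)] by blast
  qed
  also have "{x \<in> ?P. ?mt x \<notin> ?P \<and> uses x (?mt x)} =
    (\<lambda>a. (r, s, a)) ` {a \<in> A. (a = 0 \<or> a = m + 1 \<or> a = m + 2 + twist r s) \<and> use r s a}" (is "?X = _ ` ?Y")
  proof (intro subset_antisym subsetI)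
    fix x assume "x \<in> ?X"
    then obtain a where a: "x = (r, s, a)" "a \<in> A" "mate r s a \<notin> ?P" "use r s a"
      by (auto simp: use_def)
    obtain r' s' b where mt: "mate r s a = (r', s', b)" by (metis prod_cases3)
    have nb: "(r', s', b) \<in> nbrs (r, s, a)" by (simp add: nbrs_def mt)
    have "(r', s', b) \<in> S" using a(4) uses_in(2) mt by (auto simp: use_def)
    then have "(r', s') \<noteq> (r, s)" using cl[OF a(2), of b] nb a(3) mt by (auto simp: F_def)
    then show "x \<in> (\<lambda>a. (r, s, a)) ` ?Y" using nbrs_other_block(2)[OF nb refl] a by auto
  next
    fix x assume "x \<in> (\<lambda>a. (r, s, a)) ` ?Y"
    then obtain a where a: "x = (r, s, a)" "a \<in> A" "a = 0 \<or> a = m + 1 \<or> a = m + 2 + twist r s" "use r s a"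
      by auto
    have "block r s" using F_less A a by blast
    then have "mate r s a \<notin> ?P"
      using a(3) vlink_neq[of r s] rprev_neq[of r s] rnext_neq[of r s] by (auto simp: mate_def)
    then show "x \<in> ?X" using a by (auto simp: use_def)
  qed
  finally show ?thesis by (subst (asm) card_image) (auto simp: inj_on_def)
qed

abbreviation use_vert where "use_vert r s \<equiv> use r s 0"
abbreviation use_left where "use_left r s \<equiv> use r s (m + 1)"
abbreviation use_right where "use_right r s \<equiv> use r s (m + 2 + twist r s)"

text \<open>An even number of three exits is none or two of them, so the cycle passes through a
  ladder at most once.\<close>

lemma even_uses: "(use_left r s \<longleftrightarrow> use_right r s) \<longleftrightarrow> \<not> use_vert r s"
proof -
  have "even (card {a \<in> F r s. (a = 0 \<or> a = m + 1 \<or> a = m + 2 + twist r s) \<and> use r s a})"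
    by (rule even_exits) auto
  also have "{a \<in> F r s. (a = 0 \<or> a = m + 1 \<or> a = m + 2 + twist r s) \<and> use r s a} =
    (if use_vert r s then {0} else {}) \<union> (if use_left r s then {m + 1} else {}) \<union> (if use_right r s then {m + 2 + twist r s} else {})"
  proof (rule set_eqI)
    fix x
    show "x \<in> {a \<in> F r s. (a = 0 \<or> a = m + 1 \<or> a = m + 2 + twist r s) \<and> use r s a} \<longleftrightarrow>
      x \<in> (if use_vert r s then {0} else {}) \<union> (if use_left r s then {m + 1} else {}) \<union>
        (if use_right r s then {m + 2 + twist r s} else {})"
      using use_in_F[of r s x]
      by (cases "x = 0"; cases "x = m + 1"; cases "x = m + 2 + twist r s") (auto split: if_splits)
  qed
  finally show ?thesis by (auto split: if_splits)
qed

lemma use_right_rnext: "block r s \<Longrightarrow> use_right r s \<longleftrightarrow> use_left r (rnext r s)"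
  using rprev_rnext[of r s] by (simp add: use_def mate_def uses_sym)

lemma use_vert_vlink: "block r s \<Longrightarrow> use_vert r s \<longleftrightarrow> use_vert (vlink r s) s"
  using vlink_vlink[of r s] by (simp add: use_def mate_def uses_sym)

text \<open>
  If the cycle skipped the level \<open>j\<close>, its part below level \<open>j\<close> in the ladder would be left
  through the exit \<open>a\<close> only, contradicting parity.
\<close>

lemma card_F_ge:
  assumes block: "block r s" and ab: "a \<noteq> b" "use r s a" "use r s b"
    "a \<in> {0, m + 1, m + 2 + twist r s}" "b \<in> {0, m + 1, m + 2 + twist r s}"
    and f: "f a = 0" "\<And>x y. x < M \<Longrightarrow> (r, s, y) \<in> nbrs (r, s, x) \<Longrightarrow> f y \<le> f x + (1::nat)"
  shows "f b + 1 \<le> card (F r s)"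
proof -
  have only: "x = a \<or> x = b" if "x \<in> {0, m + 1, m + 2 + twist r s}" "use r s x" for x
    using that ab even_uses[of r s] by auto
  have "{0..f b} \<subseteq> f ` F r s"
  proof
    fix j assume j: "j \<in> {0..f b}"
    show "j \<in> f ` F r s"
    proof (rule ccontr)
      assume n: "j \<notin> f ` F r s"
      \<comment> \<open>The values 0 and \<open>f b\<close> are attained at the two used exits, so a
        skipped value separates them; as \<open>f\<close> rises by at most 1 along an edge, it
        cannot jump over \<open>j\<close>.\<close>
      have j': "0 < j" "j < f b" using n j f(1) use_in_F[OF ab(2)] use_in_F[OF ab(3)]
        by (metis image_eqI neq0_conv, metis atLeastAtMost_iff image_eqI le_neq_implies_less)
      let ?A = "{x \<in> F r s. f x < j}"
      have "even (card {x \<in> ?A. (x = 0 \<or> x = m + 1 \<or> x = m + 2 + twist r s) \<and> use r s x})"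
      proof (rule even_exits)
        fix x y assume "x \<in> ?A" "y \<in> F r s" "(r, s, y) \<in> nbrs (r, s, x)"
        moreover from this have "f y \<noteq> j" using n by blast
        ultimately show "y \<in> ?A" using f(2)[of x y] F_less by fastforce
      qed auto
      also have "{x \<in> ?A. (x = 0 \<or> x = m + 1 \<or> x = m + 2 + twist r s) \<and> use r s x} = {a}"
      proof (intro subset_antisym subsetI)
        fix x assume "x \<in> {x \<in> ?A. (x = 0 \<or> x = m + 1 \<or> x = m + 2 + twist r s) \<and> use r s x}"
        then show "x \<in> {a}" using only[of x] j' by auto
      qed (use ab f(1) j' use_in_F[OF ab(2)] in auto)
      finally show False by simp
    qed
  qed
  then have "card {0..f b} \<le> card (f ` F r s)" by (intro card_mono finite_imageI finite_F)
  then show ?thesis using card_image_le[OF finite_F, of f r s] by simp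
qed

lemma card_F_LV: "block r s \<Longrightarrow> use_left r s \<Longrightarrow> use_vert r s \<Longrightarrow> m + 2 \<le> card (F r s)"
  using card_F_ge[of r s 0 "m + 1" level] level_lipschitz[of r s] by (simp add: level_def)

text \<open>The right exit is on level \<open>m + 1\<close>, or in a twisted ladder, being
  \<open>m + 3\<close>, on level \<open>m\<close>; adding the twist on the right avoids a
  subtraction.\<close>

lemma card_F_RV: "block r s \<Longrightarrow> use_right r s \<Longrightarrow> use_vert r s \<Longrightarrow> m + 2 \<le> card (F r s) + twist r s"
  using card_F_ge[of r s 0 "m + 2 + twist r s" level] level_lipschitz[of r s] twist_le[of r s] m_pos
  by (simp add: level_def min_def split: if_splits)

lemma card_F_LR:
  assumes "block r s" "use_left r s" "use_right r s" shows "2 + twist r s \<le> card (F r s)"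
proof -
  \<comment> \<open>A coarse distance from the left exit that only has to separate the two exits: by
    1 if they are adjacent, by 2 if \<open>m + 2\<close> lies between them.\<close>
  define f where "f a = (if a = m + 1 then 0 else if a = m + 2 + twist r s then 1 + twist r s else 1)" for a
  have "f (m + 2 + twist r s) + 1 \<le> card (F r s)"
  proof (rule card_F_ge[where a = "m + 1" and f = f])
    fix x y assume xy: "x < M" "(r, s, y) \<in> nbrs (r, s, x)"
    show "f y \<le> f x + 1"
      using nbrs_same_block[OF assms(1) xy] twist_le[of r s] m_pos xy(1)
      by (auto simp: f_def csucc_def cpred_def split: if_splits)
  qed (use assms in \<open>auto simp: f_def\<close>)
  then show ?thesis by (simp add: f_def)
qed

lemma card_F_used:
  assumes "block r s" "use_left r s \<or> use_right r s \<or> use_vert r s" shows "2 \<le> card (F r s)"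
proof -
  have "use_left r s \<and> use_vert r s \<or> use_right r s \<and> use_vert r s \<or> use_left r s \<and> use_right r s"
    using assms even_uses[of r s] by blast
  then show ?thesis
    using card_F_LV[OF assms(1)] card_F_RV[OF assms(1)] card_F_LR[OF assms(1)] twist_le[of r s] m_pos
    by force
qed

lemma unused_imp_le:
  assumes "\<And>r s. block r s \<Longrightarrow> \<not> use_left r s \<and> \<not> use_right r s \<and> \<not> use_vert r s"
  shows "n \<le> M"
proof -
  obtain r s a where v0: "v 0 = (r, s, a)" by (metis prod_cases3)
  have "v 0 \<in> V" using v_in n_ge by simp
  then have block: "block r s" by (simp add: v0)
  let ?P = "(\<lambda>a. (r, s, a)) ` {..<M}"
  have "S \<subseteq> ?P"
  proof (rule no_exit_imp_inside)
    fix j assume j: "j < n" "v j \<in> ?P"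
    then obtain b where b: "v j = (r, s, b)" by auto
    obtain r' s' a' where y: "nxt j = (r', s', a')" by (metis prod_cases3)
    have nb: "nxt j \<in> nbrs (r, s, b)" using nxt_nbr[OF j(1)] b by simp
    have "nxt j \<in> V" using nxt_in S_V by blast
    then have a': "a' < M" by (simp add: y)
    have "(r', s') = (r, s)"
    proof (rule ccontr)
      assume ne: "(r', s') \<noteq> (r, s)"
      have "use r s b" using nbrs_other_block(1)[OF nb y ne] j b by (auto simp: use_def uses_def)
      then show False using nbrs_other_block(2)[OF nb y ne] assms[OF block] by blast
    qed
    then show "nxt j \<in> ?P" using y a' by auto
  qed (use n_ge v0 \<open>v 0 \<in> V\<close> in auto)
  then have "card S \<le> card ?P" by (intro card_mono) auto
  also have "\<dots> \<le> M" using card_image_le[of "{..<M}"] by (metis card_lessThan finite_lessThan)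
  finally show ?thesis by (simp add: card_S)
qed

section \<open>Counting ring by ring\<close>

definition W :: "nat \<Rightarrow> nat" where "W r = (\<Sum>s | block r s. card (F r s))"

lemma finite_ring: "finite {s. block r s}"
  by (rule finite_subset[of _ "{..<2 * c}"]) (auto simp: block_def)

lemma sum_W_le:
  assumes "finite R" shows "(\<Sum>r\<in>R. W r) \<le> n"
proof -
  let ?T = "SIGMA r:R. SIGMA s:{s. block r s}. F r s"
  have "(\<Sum>r\<in>R. W r) = card ?T"
    using assms finite_ring finite_F by (simp add: W_def card_SigmaI finite_SigmaI)
  also have "\<dots> \<le> card S" by (rule card_mono) (auto simp: F_def)
  finally show ?thesis by (simp add: card_S)
qed

lemma W_ge:
  assumes "\<And>s. s \<in> T \<Longrightarrow> block r s" shows "(\<Sum>s\<in>T. card (F r s)) \<le> W r"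
  unfolding W_def by (rule sum_mono2) (use assms finite_ring in auto)

lemma bij_ring: "bij_betw (rnext r) {s. block r s \<and> use_right r s} {s. block r s \<and> use_left r s}"
proof (rule bij_betwI')
  fix x y assume "x \<in> {s. block r s \<and> use_right r s}" "y \<in> {s. block r s \<and> use_right r s}"
  then show "(rnext r x = rnext r y) = (x = y)" using rprev_rnext by (metis mem_Collect_eq)
next
  fix x assume "x \<in> {s. block r s \<and> use_right r s}"
  then show "rnext r x \<in> {s. block r s \<and> use_left r s}" using block_rnext use_right_rnext by blast
next
  fix y assume "y \<in> {s. block r s \<and> use_left r s}"
  then show "\<exists>x\<in>{s. block r s \<and> use_right r s}. y = rnext r x"
    using block_rprev rnext_rprev use_right_rnext[of r "rprev r y"] by (intro bexI[of _ "rprev r y"]) auto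
qed

text \<open>
  Ladders left to the right and ladders entered from the left are equinumerous in a ring, so a ladder
  where the cycle turns from right to vertical comes with one where it turns from left to vertical.
\<close>

lemma ring_turns:
  assumes "block r s" "use_vert r s"
  shows "\<exists>s. block r s \<and> use_right r s \<and> use_vert r s" "\<exists>s. block r s \<and> use_left r s \<and> use_vert r s"
proof -
  let ?A = "{s. block r s \<and> use_right r s}" and ?B = "{s. block r s \<and> use_left r s}"
  have fin: "finite ?A" "finite ?B" using finite_ring by auto
  have card: "card ?A = card ?B" using bij_ring by (rule bij_betw_same_card)
  have s: "use_left r s \<noteq> use_right r s" using even_uses[of r s] assms by blast
  show "\<exists>s. block r s \<and> use_right r s \<and> use_vert r s"
  proof (rule ccontr)
    assume no: "\<not> ?thesis"
    then have "?A \<subseteq> ?B" using even_uses by blast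
    then have "?A = ?B" using card fin card_subset_eq by metis
    then show False using s assms no by blast
  qed
  show "\<exists>s. block r s \<and> use_left r s \<and> use_vert r s"
  proof (rule ccontr)
    assume no: "\<not> ?thesis"
    then have "?B \<subseteq> ?A" using even_uses by blast
    then have "?B = ?A" using card fin card_subset_eq by metis
    then show False using s assms no by blast
  qed
qed

lemma rnext_mod: "s < 2 * c \<Longrightarrow> rnext r s = (s + stride r) mod (2 * c)"
  using c_ge by (auto simp: rnext_def stride_def mod_if)

text \<open>Without vertical exits parity makes every ladder that is entered sideways be crossed, so
  usage spreads around the ring.\<close>

lemma ring_closed:
  assumes "block r s" "use_left r s \<or> use_right r s" "\<And>s. block r s \<Longrightarrow> \<not> use_vert r s"
  shows "2 * c \<le> n"
proof -
  let ?g = "\<lambda>i. (s + i * stride r) mod (2 * c)"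
  have "block r (?g i) \<and> use_left r (?g i) \<and> use_right r (?g i)" for i
  proof (induction i)
    case 0
    then show ?case using assms even_uses[of r s] by (auto simp: block_def)
  next
    case (Suc i)
    have "?g (Suc i) = (s + i * stride r + stride r) mod (2 * c)" by (simp add: ac_simps)
    also have "\<dots> = (?g i + stride r) mod (2 * c)" by (simp only: mod_add_left_eq)
    also have "\<dots> = rnext r (?g i)" using rnext_mod[of "?g i" r] c_ge by simp
    finally have g: "?g (Suc i) = rnext r (?g i)" .
    have b: "block r (rnext r (?g i))" using Suc block_rnext by blast
    moreover have "use_left r (rnext r (?g i))" using Suc use_right_rnext by blast
    ultimately show ?case unfolding g using assms(3)[OF b] even_uses by blast
  qed
  note g = this
  \<comment> \<open>An end ring has only \<open>c\<close> ladders, and in an inner ring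
    \<open>c\<close> of the \<open>2 * c\<close> ladders suffice; each contributes at least 2
    vertices.\<close>
  have "inj_on ?g {..<c}"
  proof (rule linorder_inj_onI')
    fix i j assume ij: "i \<in> {..<c}" "j \<in> {..<c}" "i < j"
    show "?g i \<noteq> ?g j"
    proof
      assume "?g i = ?g j"
      then have "2 * c dvd (s + j * stride r) - (s + i * stride r)"
        using ij by (subst (asm) eq_commute) (subst (asm) mod_eq_dvd_iff_nat, auto)
      then have "2 * c dvd (j - i) * stride r" by (simp add: diff_mult_distrib)
      moreover have "0 < (j - i) * stride r" "(j - i) * stride r < 2 * c" using ij by (auto simp: stride_def)
      ultimately show False using dvd_imp_le by fastforce
    qed
  qed
  then have "card (?g ` {..<c}) = c" by (simp add: card_image)
  moreover have "(\<Sum>s\<in>?g ` {..<c}. 2) \<le> (\<Sum>s\<in>?g ` {..<c}. card (F r s))"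
    by (rule sum_mono) (use g card_F_used in blast)
  ultimately have "2 * c \<le> (\<Sum>s\<in>?g ` {..<c}. card (F r s))" by simp
  also have "\<dots> \<le> W r" by (rule W_ge) (use g in blast)
  also have "\<dots> \<le> n" using sum_W_le[of "{r}"] by simp
  finally show ?thesis .
qed

lemma W_turn:
  assumes s1: "block r s1" "use_right r s1" "use_vert r s1" and s2: "block r s2" "use_left r s2" "use_vert r s2"
  shows "2 * m + 4 \<le> W r + twist r s1"
    and "\<not> use_vert r (rnext r s1) \<Longrightarrow> 2 * m + 6 + twist r (rnext r s1) \<le> W r + twist r s1"
proof -
  have 12: "s1 \<noteq> s2" using s1 s2 even_uses by blast
  have c1: "m + 2 \<le> card (F r s1) + twist r s1" using card_F_RV s1 by blast
  have c2: "m + 2 \<le> card (F r s2)" using card_F_LV s2 by blast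
  have "(\<Sum>s\<in>{s1, s2}. card (F r s)) \<le> W r" by (rule W_ge) (use s1 s2 in auto)
  then show "2 * m + 4 \<le> W r + twist r s1" using c1 c2 12 by simp
  assume nv: "\<not> use_vert r (rnext r s1)"
  have b3: "block r (rnext r s1)" using s1 block_rnext by blast
  have "use_left r (rnext r s1)" using use_right_rnext s1 by blast
  then have c3: "2 + twist r (rnext r s1) \<le> card (F r (rnext r s1))"
    using card_F_LR[OF b3] nv even_uses by blast
  have ne: "rnext r s1 \<noteq> s1" "rnext r s1 \<noteq> s2" using nv s1 s2 by auto
  have "(\<Sum>s\<in>{s1, s2, rnext r s1}. card (F r s)) \<le> W r" by (rule W_ge) (use s1 s2 b3 in auto)
  then show "2 * m + 6 + twist r (rnext r s1) \<le> W r + twist r s1" using c1 c2 c3 12 ne by simp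
qed

lemma parity_rnext: "block r s \<Longrightarrow> r \<in> {1, 2, 3} \<Longrightarrow> even (rnext r s) \<longleftrightarrow> odd s"
  using c_ge by (auto simp: rnext_def stride_def block_def)

text \<open>All used links point to ring \<open>r + 1\<close>, so in an inner ring the ladder after
  the right turn has the wrong parity for turning and is crossed. The surplus over
  \<open>2 * m + 4\<close> is 0 in ring 0, \<open>2 - 1\<close> in ring 1 (twisted turn), 2 in ring
  2 and 3 in ring 3 (twisted crossing); ring 4 has no further link.\<close>

lemma W_top:
  assumes "block r s" "use_vert r s" and top: "\<And>s. block r s \<Longrightarrow> use_vert r s \<Longrightarrow> even (r + s)"
  shows "2 * m + 4 + r \<le> W r"
proof -
  obtain s1 s2 where s1: "block r s1" "use_right r s1" "use_vert r s1" and s2: "block r s2" "use_left r s2" "use_vert r s2"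
    using ring_turns[OF assms(1,2)] by blast
  have e: "even (r + s1)" using top s1 by blast
  have nv: "\<not> use_vert r (rnext r s1)" if "r \<in> {1, 2, 3}"
    using top[of "rnext r s1"] block_rnext[OF s1(1)] parity_rnext[OF s1(1) that] e by auto
  consider "r = 0" | "r = 1" | "r = 2" | "r = 3" | "r = 4" using assms(1) by (force simp: block_def)
  then show ?thesis
  proof cases
    case 1 then show ?thesis using W_turn(1)[OF s1 s2] by (simp add: twist_def)
  next
    case 5 then show ?thesis using e s1(1) by (auto simp: block_def)
  qed (use W_turn(2)[OF s1 s2] nv e parity_rnext[OF s1(1)] in \<open>simp_all add: twist_def split: if_splits\<close>)
qed

text \<open>The mirror image of \<open>W_top\<close>: now the crossing is twisted in ring 1 and the
  turn in ring 3, and the surplus is \<open>4 - r\<close>.\<close>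

lemma W_bottom:
  assumes "block r s" "use_vert r s" and bot: "\<And>s. block r s \<Longrightarrow> use_vert r s \<Longrightarrow> odd (r + s)"
  shows "2 * m + 8 \<le> W r + r"
proof -
  obtain s1 s2 where s1: "block r s1" "use_right r s1" "use_vert r s1" and s2: "block r s2" "use_left r s2" "use_vert r s2"
    using ring_turns[OF assms(1,2)] by blast
  have e: "odd (r + s1)" using bot s1 by blast
  have nv: "\<not> use_vert r (rnext r s1)" if "r \<in> {1, 2, 3}"
    using bot[of "rnext r s1"] block_rnext[OF s1(1)] parity_rnext[OF s1(1) that] e by auto
  consider "r = 0" | "r = 1" | "r = 2" | "r = 3" | "r = 4" using assms(1) by (force simp: block_def)
  then show ?thesis
  proof cases
    case 1 then show ?thesis using e s1(1) by (auto simp: block_def)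
  next
    case 5 then show ?thesis using W_turn(1)[OF s1 s2] by (simp add: twist_def)
  qed (use W_turn(2)[OF s1 s2] nv e parity_rnext[OF s1(1)] in \<open>simp_all add: twist_def split: if_splits\<close>)
qed

lemma cycle_length:
  assumes c: "2 * m + 6 \<le> c"
  shows "n \<le> M \<or> 4 * m + 11 \<le> n"
proof (rule disjCI)
  assume short: "\<not> 4 * m + 11 \<le> n"
  show "n \<le> M"
  proof (rule unused_imp_le, rule ccontr)
    fix r s assume "block r s" and us: "\<not> (\<not> use_left r s \<and> \<not> use_right r s \<and> \<not> use_vert r s)"
    define Q where "Q = {r. \<exists>s. block r s \<and> (use_left r s \<or> use_right r s \<or> use_vert r s)}"
    have Q4: "Q \<subseteq> {..4}" by (auto simp: Q_def block_def)
    have fin: "finite Q" using Q4 finite_subset by blast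
    have ne: "Q \<noteq> {}" using \<open>block r s\<close> us by (auto simp: Q_def)
    \<comment> \<open>A used ring without vertical exits would cost \<open>2 * c\<close> vertices,
      at least \<open>4 * m + 12\<close>; this fixes the lower bound on \<open>c\<close>.\<close>
    have hasV: "\<exists>s. block r s \<and> use_vert r s" if rQ: "r \<in> Q" for r
    proof (rule ccontr)
      assume "\<not> ?thesis"
      then have nV: "\<And>s. block r s \<Longrightarrow> \<not> use_vert r s" by blast
      obtain s where "block r s" "use_left r s \<or> use_right r s" using rQ nV by (auto simp: Q_def)
      then show False using ring_closed[OF _ _ nV] c short by force
    qed
    have vQ: "vlink r s \<in> Q" if "block r s" "use_vert r s" for r s
      using that(2) block_vlink[OF that(1)] use_vert_vlink[OF that(1)] unfolding Q_def by blast
    define t where "t = Min Q"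
    define b where "b = Max Q"
    have tQ: "t \<in> Q" and bQ: "b \<in> Q" using fin ne by (auto simp: t_def b_def)
    have tmin: "t \<le> q" and bmax: "q \<le> b" if "q \<in> Q" for q using that fin by (auto simp: t_def b_def)
    \<comment> \<open>A link pointing outwards from an extreme ring would make the cycle use a ring
      beyond it.\<close>
    have up: "even (t + s)" if "block t s" "use_vert t s" for s
    proof (rule ccontr)
      assume o: "odd (t + s)"
      then have "t \<noteq> 0" using that by (auto simp: block_def)
      then show False using tmin[OF vQ[OF that]] o by (simp add: vlink_def)
    qed
    have dn: "odd (b + s)" if "block b s" "use_vert b s" for s
    proof (rule ccontr)
      assume "\<not> odd (b + s)"
      then show False using bmax[OF vQ[OF that]] by (simp add: vlink_def)
    qed
    obtain st where st: "block t st" "use_vert t st" using hasV[OF tQ] by blast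
    obtain sb where sb: "block b sb" "use_vert b sb" using hasV[OF bQ] by blast
    have Wt: "2 * m + 4 + t \<le> W t" using W_top[OF st up] by blast
    have Wb: "2 * m + 8 \<le> W b + b" using W_bottom[OF sb dn] by blast
    have "t + 1 \<in> Q" using vQ[OF st] up[OF st] by (simp add: vlink_def)
    then have tb: "t + 1 \<le> b" by (rule bmax)
    have b4: "b \<le> 4" using bQ Q4 by auto
    show False
    proof (cases "b = t + 1")
      \<comment> \<open>The surpluses \<open>t\<close> and \<open>4 - b\<close> add up to 3, the
        exact bound.\<close>
      case True
      then show False using sum_W_le[of "{t, b}"] Wt Wb short by simp
    next
      case False
      \<comment> \<open>With \<open>b - t\<close> up to 4 the two surpluses may cancel. Both turns
        of ring \<open>t\<close> lead into different ladders of ring \<open>t + 1\<close>, which is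
        now distinct from ring \<open>b\<close>; their 2 vertices each restore the bound.\<close>
      obtain s1 s2 where s1: "block t s1" "use_right t s1" "use_vert t s1" and s2: "block t s2" "use_left t s2" "use_vert t s2"
        using ring_turns[OF st] by blast
      have 12: "s1 \<noteq> s2" using s1 s2 even_uses by blast
      have v: "vlink t s1 = t + 1" "vlink t s2 = t + 1" using up s1 s2 by (auto simp: vlink_def)
      have bl: "block (t + 1) s1" "block (t + 1) s2" using block_vlink s1 s2 v by metis+
      moreover have "use_vert (t + 1) s1" "use_vert (t + 1) s2" using use_vert_vlink s1 s2 v by metis+
      ultimately have "2 \<le> card (F (t + 1) s1)" "2 \<le> card (F (t + 1) s2)" using card_F_used by blast+
      moreover have "(\<Sum>s\<in>{s1, s2}. card (F (t + 1) s)) \<le> W (t + 1)" by (rule W_ge) (use bl in auto)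
      ultimately have "4 \<le> W (t + 1)" using 12 by simp
      then show False using sum_W_le[of "{t, t + 1, b}"] Wt Wb short False tb b4 by simp
    qed
  qed
qed

end

subsection \<open>Connectivity\<close>

text \<open>A cycle without one of its points is still a path. The relation \<open>Q\<close> is
  abstract because this is applied both to the vertices of a ladder and to the ladders of a
  ring.\<close>

lemma cyclic_connected:
  fixes Q :: "'b \<Rightarrow> 'b \<Rightarrow> bool" and g :: "nat \<Rightarrow> 'b"
  assumes refl: "\<And>x. Q x x" and sym: "\<And>x y. Q x y \<Longrightarrow> Q y x"
    and trans: "\<And>x y z. Q x y \<Longrightarrow> Q y z \<Longrightarrow> Q x z"
    and step: "\<And>i. i < n \<Longrightarrow> i \<noteq> d \<Longrightarrow> Suc i mod n \<noteq> d \<Longrightarrow> Q (g i) (g (Suc i mod n))"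
    and d: "d < n" and ij: "i < n" "i \<noteq> d" "j < n" "j \<noteq> d"
  shows "Q (g i) (g j)"
proof -
  \<comment> \<open>The path starts just after the gap \<open>d\<close>, and its last index is
    \<open>n - 2\<close>.\<close>
  let ?h = "\<lambda>t. (d + 1 + t) mod n"
  have ne: "?h t \<noteq> d" if "t + 1 < n" for t
  proof (cases "d + 1 + t < n")
    case False
    then have "?h t = d + 1 + t - n" using that d by (simp add: mod_if)
    then show ?thesis using False that by simp
  qed simp
  have path: "t + 1 < n \<Longrightarrow> Q (g (?h 0)) (g (?h t))" for t
  proof (induction t)
    case (Suc t)
    have eq: "?h (Suc t) = Suc (?h t) mod n" by (simp add: mod_Suc_eq)
    have "Q (g (?h t)) (g (Suc (?h t) mod n))"
      using Suc.prems ne[of t] ne[of "Suc t"] unfolding eq by (intro step) auto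
    moreover have "Q (g (?h 0)) (g (?h t))" using Suc by simp
    ultimately show ?case unfolding eq using trans by blast
  qed (rule refl)
  have from0: "Q (g (?h 0)) (g l)" if l: "l < n" "l \<noteq> d" for l
  proof (cases "d < l")
    case True
    then have "?h (l - d - 1) = l" using l by simp
    then show ?thesis using path[of "l - d - 1"] True l by simp
  next
    case False
    then have "d + 1 + (l + n - d - 1) = l + n" using l d by simp
    then have "?h (l + n - d - 1) = l" using l by simp
    then show ?thesis using path[of "l + n - d - 1"] False l d by simp
  qed
  show ?thesis using from0[OF ij(1,2)] from0[OF ij(3,4)] sym trans by blast
qed

locale wall_removal = ladder_wall +
  fixes X :: "(nat \<times> nat \<times> nat) set"
  assumes X_V: "X \<subseteq> V" and card_X: "card X \<le> 2"
begin

definition R :: "((nat \<times> nat \<times> nat) \<times> (nat \<times> nat \<times> nat)) set" where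
  "R = parcs wall \<inter> (V - X) \<times> (V - X)"

definition conn :: "nat \<times> nat \<times> nat \<Rightarrow> nat \<times> nat \<times> nat \<Rightarrow> bool" where
  "conn x y \<longleftrightarrow> (x, y) \<in> R\<^sup>*"

lemma finite_X: "finite X" using X_V finite_V finite_subset by blast

lemma sym_R: "sym R"
proof (rule symI)
  fix x y assume "(x, y) \<in> R"
  then show "(y, x) \<in> R" using nbrs_sym[of x y] by (simp add: R_def)
qed

lemma conn_refl: "conn x x" by (simp add: conn_def)

lemma conn_sym: "conn x y \<Longrightarrow> conn y x"
  using sym_rtrancl[OF sym_R] by (auto simp: conn_def dest: symD)

lemma conn_trans: "conn x y \<Longrightarrow> conn y z \<Longrightarrow> conn x z"
  unfolding conn_def by (rule rtrancl_trans)

lemma conn_arc: "x \<in> V \<Longrightarrow> x \<notin> X \<Longrightarrow> y \<in> nbrs x \<Longrightarrow> y \<notin> X \<Longrightarrow> conn x y"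
  using nbr_in_V[of x y] by (auto simp: conn_def R_def intro!: r_into_rtrancl)

definition rem :: "nat \<Rightarrow> nat \<Rightarrow> nat set" where "rem r s = {a. (r, s, a) \<in> X}"

section \<open>Connections left inside one ladder\<close>

lemma conn_csucc:
  "block r s \<Longrightarrow> a < M \<Longrightarrow> a \<notin> rem r s \<Longrightarrow> csucc a \<notin> rem r s \<Longrightarrow> conn (r, s, a) (r, s, csucc a)"
  by (rule conn_arc) (auto simp: rem_def nbrs_def)

lemma conn_mate:
  assumes "block r s" "a < M" "a \<notin> rem r s" "mate r s a = (r', s', b)" "b \<notin> rem r' s'"
  shows "conn (r, s, a) (r', s', b)"
  by (rule conn_arc) (use assms in \<open>auto simp: rem_def nbrs_def\<close>)

lemma conn_chord:
  assumes "block r s" "a < M" "a \<notin> rem r s" "a \<noteq> 0" "a \<noteq> m + 1" "a \<noteq> m + 2 + twist r s"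
    "chord (twist r s) a \<notin> rem r s"
  shows "conn (r, s, a) (r, s, chord (twist r s) a)"
  using conn_mate[OF assms(1-3), of r s "chord (twist r s) a"] assms by (simp add: mate_def)

lemma conn_interval:
  assumes "block r s" "i \<le> j" "j < M" "\<And>a. i \<le> a \<Longrightarrow> a \<le> j \<Longrightarrow> a \<notin> rem r s"
  shows "conn (r, s, i) (r, s, j)"
  using assms(2-4)
proof (induction j rule: dec_induct)
  case base then show ?case by (simp add: conn_refl)
next
  case (step j)
  have "conn (r, s, j) (r, s, csucc j)"
    using step by (intro conn_csucc assms(1)) (auto simp: csucc_def)
  then show ?case using step conn_trans by (auto simp: csucc_def)
qed

lemma csucc_mod: "a < M \<Longrightarrow> csucc a = Suc a mod M"
  by (auto simp: csucc_def mod_Suc)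

lemma block_connected:
  assumes "block r s" "rem r s \<subseteq> {d}" "a < M" "a \<notin> rem r s" "b < M" "b \<notin> rem r s"
  shows "conn (r, s, a) (r, s, b)"
proof (cases "rem r s = {}")
  case True
  have *: "conn (r, s, a) (r, s, b)" if "a \<le> b" "b < M" for a b
    by (rule conn_interval) (use that assms(1) True in auto)
  show ?thesis using *[of a b] *[of b a] conn_sym assms by (cases "a \<le> b") auto
next
  case False
  then have d: "rem r s = {d}" using assms by auto
  then have "(r, s, d) \<in> V" using X_V by (auto simp: rem_def)
  then have dM: "d < M" by simp
  show ?thesis
  proof (rule cyclic_connected[where Q = conn and n = M and d = d and g = "\<lambda>a. (r, s, a)"])
    fix i assume "i < M" "i \<noteq> d" "Suc i mod M \<noteq> d"
    then show "conn (r, s, i) (r, s, Suc i mod M)"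
      using conn_csucc[of r s i] csucc_mod[of i] assms(1) d by simp
  qed (use conn_refl conn_sym conn_trans dM assms d in \<open>blast | simp\<close>)+
qed

text \<open>Two removed vertices may disconnect a ladder, but they cut no vertex off from all exits.
  If both ways along the Hamiltonian cycle to the nearest exits are blocked, both removed vertices
  are spent there, and the chord leads to the free opposite side.\<close>

lemma reach_exit:
  assumes block: "block r s" and sub: "rem r s \<subseteq> {x, y}" and a: "a < M" "a \<notin> rem r s"
  shows "\<exists>e\<in>{0, m + 1, m + 2 + twist r s}. e \<notin> rem r s \<and> conn (r, s, a) (r, s, e)"
proof -
  note twist = twist_le[of r s]
  note iv = conn_interval[OF block]
  have two: "b = z \<or> b = z'" if "z \<in> rem r s" "z' \<in> rem r s" "z \<noteq> z'" "b \<in> rem r s" for b z z'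
    using that sub by blast
  consider (exit) "a \<in> {0, m + 1, m + 2 + twist r s}" | (left) "0 < a" "a \<le> m"
    | (mid) "a = m + 2" "twist r s = 1" | (right) "m + 2 + twist r s < a"
    using twist by fastforce
  then show ?thesis
  proof cases
    case exit
    then show ?thesis using a conn_refl by blast
  next
    case left
    show ?thesis
    proof (cases "\<exists>z\<in>rem r s. z < a")
      case False
      then have "conn (r, s, 0) (r, s, a)" using a by (intro iv) (auto simp: le_less)
      moreover have "0 \<notin> rem r s" using False left by auto
      ultimately show ?thesis using conn_sym by blast
    next
      case z: True
      show ?thesis
      proof (cases "\<exists>z\<in>rem r s. a < z \<and> z \<le> m + 1")
        case False
        then have "conn (r, s, a) (r, s, m + 1)" using a left by (intro iv) (auto simp: le_less)
        moreover have "m + 1 \<notin> rem r s" using False left by auto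
        ultimately show ?thesis by blast
      next
        case True
        have free: "b \<notin> rem r s" if "m + 2 \<le> b" for b
        proof
          assume "b \<in> rem r s"
          moreover obtain z1 z2 where "z1 \<in> rem r s" "z1 < a" "z2 \<in> rem r s" "a < z2" "z2 \<le> m + 1"
            using z True by blast
          ultimately show False using two[of z1 z2 b] that left by auto
        qed
        let ?b = "chord (twist r s) a"
        have b: "m + 2 \<le> ?b" "?b < M" using left twist by (auto simp: chord_def)
        have "conn (r, s, a) (r, s, ?b)"
          using left by (intro conn_chord block a free b(1)) auto
        moreover have "conn (r, s, ?b) (r, s, m + 2 + twist r s)"
        proof (cases "?b \<le> m + 2 + twist r s")
          case True
          show ?thesis using True b twist m_pos by (intro iv free) auto
        next
          case False
          have "conn (r, s, m + 2 + twist r s) (r, s, ?b)" using False b by (intro iv free) auto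
          then show ?thesis by (rule conn_sym)
        qed
        ultimately have "conn (r, s, a) (r, s, m + 2 + twist r s)" by (rule conn_trans)
        then show ?thesis using free[of "m + 2 + twist r s"] by auto
      qed
    qed
  next
    \<comment> \<open>In a twisted ladder \<open>m + 2\<close> sits between the left and the right
      exit; if both are removed, its chord leads to \<open>m\<close> and from there the side is free
      down to \<open>0\<close>.\<close>
    case mid
    show ?thesis
    proof (cases "m + 1 \<in> rem r s \<and> m + 3 \<in> rem r s")
      case True
      have free: "b \<notin> rem r s" if "b \<le> m" for b
        using two[of "m + 1" "m + 3" b] True that by auto
      have "conn (r, s, a) (r, s, m)"
        using conn_chord[OF block a] mid free[of m] by (simp add: chord_def)
      moreover have "conn (r, s, 0) (r, s, m)" by (intro iv free) auto
      ultimately show ?thesis using free[of 0] conn_sym conn_trans by blast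
    next
      case False
      then consider "m + 1 \<notin> rem r s" | "m + 3 \<notin> rem r s" by blast
      then show ?thesis
      proof cases
        case 1
        have "conn (r, s, m + 1) (r, s, csucc (m + 1))"
          using 1 a mid by (intro conn_csucc block) (auto simp: csucc_def)
        then have "conn (r, s, a) (r, s, m + 1)" using mid m_pos conn_sym by (auto simp: csucc_def)
        then show ?thesis using 1 by blast
      next
        case 2
        have "conn (r, s, a) (r, s, csucc a)"
          using 2 a mid m_pos by (intro conn_csucc block) (auto simp: csucc_def numeral_3_eq_3)
        then have "conn (r, s, a) (r, s, m + 2 + twist r s)"
          using mid m_pos by (auto simp: csucc_def numeral_3_eq_3)
        then show ?thesis using 2 mid by (auto simp: numeral_3_eq_3)
      qed
    qed
  next
    case right
    show ?thesis
    proof (cases "\<exists>z\<in>rem r s. m + 2 + twist r s \<le> z \<and> z < a")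
      case False
      then have "conn (r, s, m + 2 + twist r s) (r, s, a)" using a right by (intro iv) (auto simp: le_less)
      moreover have "m + 2 + twist r s \<notin> rem r s" using False right by auto
      ultimately show ?thesis using conn_sym by blast
    next
      case z: True
      show ?thesis
      proof (cases "\<exists>z\<in>rem r s. a < z \<or> z = 0")
        case False
        then have "conn (r, s, a) (r, s, 2 * m + 2)" using a by (intro iv) (auto simp: le_less)
        moreover have "conn (r, s, 2 * m + 2) (r, s, csucc (2 * m + 2))"
        proof (intro conn_csucc block)
          show "2 * m + 2 \<notin> rem r s"
          proof
            assume *: "2 * m + 2 \<in> rem r s"
            then have "a = 2 * m + 2" using False a(1) by fastforce
            then show False using * a(2) by simp
          qed
          show "csucc (2 * m + 2) \<notin> rem r s" using False by (auto simp: csucc_def)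
        qed simp
        ultimately have "conn (r, s, a) (r, s, 0)" using conn_trans by (auto simp: csucc_def)
        then show ?thesis using False by auto
      next
        case True
        have free: "b \<notin> rem r s" if "0 < b" "b \<le> m + 1" for b
        proof
          assume "b \<in> rem r s"
          moreover obtain z1 z2 where "z1 \<in> rem r s" "m + 2 + twist r s \<le> z1" "z1 < a"
            "z2 \<in> rem r s" "a < z2 \<or> z2 = 0"
            using z True by blast
          ultimately show False using two[of z1 z2 b] that right by auto
        qed
        let ?b = "chord (twist r s) a"
        have b: "0 < ?b" "?b \<le> m + 1" using right a twist by (auto simp: chord_def)
        have "conn (r, s, a) (r, s, ?b)"
          using right by (intro conn_chord block a free b) auto
        moreover have "conn (r, s, ?b) (r, s, m + 1)" using b by (intro iv free) auto
        ultimately have "conn (r, s, a) (r, s, m + 1)" by (rule conn_trans)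
        then show ?thesis using free[of "m + 1"] by auto
      qed
    qed
  qed
qed

section \<open>Connections left between ladders\<close>

definition touched :: "(nat \<times> nat) set" where
  "touched = {(r, s). rem r s \<noteq> {}}"

lemma touched_eq: "touched = (\<lambda>(r, s, a). (r, s)) ` X"
  by (force simp: touched_def rem_def)

lemma finite_touched: "finite touched" and card_touched: "card touched \<le> 2"
  using finite_X card_X card_image_le[OF finite_X, of "\<lambda>(r, s, a). (r, s)"] by (auto simp: touched_eq)

lemma touched_two:
  assumes "p \<in> touched" "q \<in> touched" "t \<in> touched" "p \<noteq> q" shows "t = p \<or> t = q"
proof (rule ccontr)
  assume "\<not> ?thesis"
  then have "card {p, q, t} = 3" using assms by auto
  moreover have "card {p, q, t} \<le> card touched" using assms finite_touched by (intro card_mono) auto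
  ultimately show False using card_touched by simp
qed

definition intact :: "nat \<Rightarrow> nat \<Rightarrow> bool" where "intact r s \<longleftrightarrow> block r s \<and> (r, s) \<notin> touched"

text \<open>Vertex \<open>0\<close> stands for the whole ladder, which is adequate for intact
  ladders, as these are connected.\<close>

definition block_conn :: "nat \<times> nat \<Rightarrow> nat \<times> nat \<Rightarrow> bool" where
  "block_conn p q \<longleftrightarrow> conn (fst p, snd p, 0) (fst q, snd q, 0)"

lemma block_conn_refl: "block_conn p p" and block_conn_sym: "block_conn p q \<Longrightarrow> block_conn q p"
  and block_conn_trans: "block_conn p q \<Longrightarrow> block_conn q t \<Longrightarrow> block_conn p t"
  unfolding block_conn_def using conn_refl conn_sym conn_trans by blast+

lemma intact_rem: "intact r s \<Longrightarrow> rem r s = {}" by (auto simp: intact_def touched_def)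

lemma intact_conn:
  assumes "intact r s" "a < M" "b < M" shows "conn (r, s, a) (r, s, b)"
  by (rule block_connected[where d = 0]) (use assms intact_rem[OF assms(1)] in \<open>auto simp: intact_def\<close>)

lemma block_conn_mate:
  assumes "intact r s" "intact r' s'" "a < M" "b < M" "mate r s a = (r', s', b)" shows "block_conn (r, s) (r', s')"
proof -
  have "conn (r, s, a) (r', s', b)"
    by (rule conn_mate) (use assms intact_rem[OF assms(1)] intact_rem[OF assms(2)] in \<open>auto simp: intact_def\<close>)
  moreover have "conn (r, s, 0) (r, s, a)" using intact_conn[OF assms(1) _ assms(3), of 0] by simp
  moreover have "conn (r', s', b) (r', s', 0)" using intact_conn[OF assms(2,4), of 0] by simp
  ultimately show ?thesis unfolding block_conn_def fst_conv snd_conv by (blast intro: conn_trans)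
qed

lemma block_conn_rnext: "intact r s \<Longrightarrow> intact r (rnext r s) \<Longrightarrow> block_conn (r, s) (r, rnext r s)"
  by (rule block_conn_mate[where a = "m + 2 + twist r s" and b = "m + 1"])
    (use twist_le[of r s] m_pos in \<open>auto simp: mate_def\<close>)

lemma block_conn_vlink: "intact r s \<Longrightarrow> intact (vlink r s) s \<Longrightarrow> block_conn (r, s) (vlink r s, s)"
  by (rule block_conn_mate[where a = 0 and b = 0]) (auto simp: mate_def)

text \<open>Numbers the ladders of any ring consecutively, hiding the different strides of end rings
  and inner rings.\<close>

lemma ring_param:
  assumes "r \<le> 4"
  obtains N g where "0 < N" "\<And>s. block r s \<longleftrightarrow> (\<exists>i<N. s = g i)"
    "\<And>i. i < N \<Longrightarrow> rnext r (g i) = g (Suc i mod N)" "\<And>i j. g i = g j \<Longrightarrow> i = j"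
proof -
  consider "r = 0" | "r = 4" | "r \<in> {1, 2, 3}" using assms by force
  then show thesis
  proof cases
    case 1
    show thesis
    proof (rule that[of c "\<lambda>i. 2 * i"])
      show "block r s \<longleftrightarrow> (\<exists>i<c. s = 2 * i)" for s using 1 by (auto simp: block_def elim!: evenE)
      show "rnext r (2 * i) = 2 * (Suc i mod c)" if "i < c" for i
        using that 1 by (auto simp: rnext_def stride_def mod_Suc)
    qed (use c_ge in auto)
  next
    case 2
    show thesis
    proof (rule that[of c "\<lambda>i. 2 * i + 1"])
      show "block r s \<longleftrightarrow> (\<exists>i<c. s = 2 * i + 1)" for s using 2 by (auto simp: block_def elim!: oddE)
      show "rnext r (2 * i + 1) = 2 * (Suc i mod c) + 1" if "i < c" for i
      proof (cases "Suc i = c")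
        case True
        then have "2 * i + 1 + stride r = 2 * c + 1" using 2 by (simp add: stride_def)
        then show ?thesis using True by (simp add: rnext_def)
      next
        case False
        then show ?thesis using that 2 by (simp add: rnext_def stride_def mod_Suc)
      qed
    qed (use c_ge in auto)
  next
    case 3
    show thesis
    proof (rule that[of "2 * c" "\<lambda>i. i"])
      show "block r s \<longleftrightarrow> (\<exists>i<2 * c. s = i)" for s using 3 by (auto simp: block_def)
      show "rnext r i = Suc i mod (2 * c)" if "i < 2 * c" for i
        using that 3 by (auto simp: rnext_def stride_def mod_Suc)
    qed (use c_ge in auto)
  qed
qed

lemma ring_connected:
  assumes d: "\<And>s. (r, s) \<in> touched \<Longrightarrow> s = d" and st: "intact r s" "intact r t"
  shows "block_conn (r, s) (r, t)"
proof -
  have "r \<le> 4" using st by (simp add: intact_def block_def)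
  then obtain N g where N: "0 < N" and g: "\<And>s. block r s \<longleftrightarrow> (\<exists>i<N. s = g i)"
    "\<And>i. i < N \<Longrightarrow> rnext r (g i) = g (Suc i mod N)" "\<And>i j. g i = g j \<Longrightarrow> i = j"
    by (rule ring_param) blast
  obtain i j where ij: "i < N" "s = g i" "j < N" "t = g j" using st g(1) by (auto simp: intact_def)
  have ubg: "intact r (g l)" if "l < N" "(r, g l) \<notin> touched" for l
    using that g(1) by (auto simp: intact_def)
  have step: "block_conn (r, g l) (r, g (Suc l mod N))"
    if "l < N" "(r, g l) \<notin> touched" "(r, g (Suc l mod N)) \<notin> touched" for l
    using block_conn_rnext[of r "g l"] ubg[OF that(1,2)] ubg[of "Suc l mod N"] that N g(2)[OF that(1)] by simp
  show ?thesis
  proof (cases "\<exists>l<N. (r, g l) \<in> touched")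
    case True
    then obtain l where l: "l < N" "(r, g l) \<in> touched" by blast
    have only: "(r, g i) \<in> touched \<longleftrightarrow> i = l" for i
      using d[of "g i"] d[of "g l"] l g(3)[of i l] by auto
    have "block_conn (r, g i) (r, g j)"
    proof (rule cyclic_connected[where Q = block_conn and g = "\<lambda>i. (r, g i)" and n = N and d = l])
      show "block_conn (r, g i) (r, g (Suc i mod N))" if "i < N" "i \<noteq> l" "Suc i mod N \<noteq> l" for i
        using step[of i] that only by blast
      show "i \<noteq> l" "j \<noteq> l" using st ij only by (auto simp: intact_def)
    qed (use block_conn_refl block_conn_sym block_conn_trans l ij in blast)+
    then show ?thesis by (simp add: ij)
  next
    case False
    have up: "block_conn (r, g 0) (r, g l)" if "l < N" for l
      using that
    proof (induction l)
      case (Suc l)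
      have "block_conn (r, g l) (r, g (Suc l))" using step[of l] False Suc.prems by simp
      then show ?case using block_conn_trans[OF Suc.IH] Suc.prems by simp
    qed (rule block_conn_refl)
    show ?thesis using up[OF ij(1)] up[OF ij(3)] ij block_conn_sym block_conn_trans by blast
  qed
qed

text \<open>
  Two removed vertices miss one of the three column pairs \<open>{0, 1}\<close>, \<open>{2, 3}\<close>, \<open>{4, 5}\<close>; an intact column
  pair connects all rings.
\<close>

lemma spine:
  obtains p where "\<And>r. r \<le> 4 \<Longrightarrow> \<exists>s. intact r s \<and> block_conn (r, s) (1, 2 * p)" "intact 1 (2 * p)"
proof -
  let ?f = "\<lambda>(r, s). s div 2"
  have "card (?f ` touched) \<le> 2" using card_image_le[OF finite_touched, of ?f] card_touched by simp
  have "\<exists>p\<in>{0, 1, 2}. p \<notin> ?f ` touched"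
  proof (rule ccontr)
    assume "\<not> ?thesis"
    then have "{0, 1, 2} \<subseteq> ?f ` touched" by blast
    from card_mono[OF finite_imageI[OF finite_touched] this] \<open>card (?f ` touched) \<le> 2\<close>
    show False by simp
  qed
  then obtain p where "p \<in> {0, 1, 2}" and p2: "p \<notin> ?f ` touched" by (rule bexE)
  then have p: "p \<le> 2" "p \<notin> ?f ` touched" by auto
  have nt: "(r, s) \<notin> touched" if "s div 2 = p" for r s using p(2) that by force
  have u: "intact r s" if "block r s" "s = 2 * p \<or> s = 2 * p + 1" for r s
    using that nt[of s r] by (auto simp: intact_def)
  let ?e = "2 * p" and ?o = "2 * p + 1"
  \<comment> \<open>Three disjoint column pairs exist because \<open>3 \<le> c\<close>. The route
    from end to end, as the parity of \<open>r + s\<close> permits, is \<open>(0, ?e), (1, ?e), (1,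
    ?o), (2, ?o), (2, ?e), (3, ?e), (3, ?o), (4, ?o)\<close>.\<close>
  have lt: "?o < 2 * c" using p c_ge by simp
  have U: "intact 0 ?e" "intact 1 ?e" "intact 1 ?o" "intact 2 ?e" "intact 2 ?o" "intact 3 ?e" "intact 3 ?o" "intact 4 ?o"
    using lt by (auto intro!: u simp: block_def)
  have h: "block_conn (r, ?e) (r, ?o)" if "r \<in> {1, 2, 3}" "intact r ?e" "intact r ?o" for r
  proof -
    have "rnext r ?e = ?o" using that(1) lt by (auto simp: rnext_def stride_def)
    then show ?thesis using block_conn_rnext[of r ?e] that by simp
  qed
  have v: "block_conn (r', s) (r, s)" if "even (r + s)" "r' = r + 1" "intact r s" "intact r' s" for r r' s
    using block_conn_sym[OF block_conn_vlink[of r s]] that by (simp add: vlink_def)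
  have b0: "block_conn (0, ?e) (1, ?e)" by (rule block_conn_sym[OF v]) (use U in simp_all)
  have b1: "block_conn (1, ?o) (1, ?e)" by (rule block_conn_sym[OF h]) (use U in simp_all)
  have "block_conn (2, ?o) (1, ?o)" by (rule v) (use U in simp_all)
  from block_conn_trans[OF this b1] have b2: "block_conn (2, ?o) (1, ?e)" .
  have "block_conn (2, ?e) (2, ?o)" by (rule h) (use U in simp_all)
  from block_conn_trans[OF this b2] have b2': "block_conn (2, ?e) (1, ?e)" .
  have "block_conn (3, ?e) (2, ?e)" by (rule v) (use U in simp_all)
  from block_conn_trans[OF this b2'] have b3: "block_conn (3, ?e) (1, ?e)" .
  have "block_conn (3, ?o) (3, ?e)" by (rule block_conn_sym[OF h]) (use U in simp_all)
  from block_conn_trans[OF this b3] have b3': "block_conn (3, ?o) (1, ?e)" .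
  have "block_conn (4, ?o) (3, ?o)" by (rule v) (use U in simp_all)
  from block_conn_trans[OF this b3'] have b4: "block_conn (4, ?o) (1, ?e)" .
  show thesis
  proof (rule that)
    fix r :: nat assume "r \<le> 4"
    then consider "r = 0" | "r = 1" | "r = 2" | "r = 3" | "r = 4" by force
    then show "\<exists>s. intact r s \<and> block_conn (r, s) (1, 2 * p)"
      by cases (use U b0 block_conn_refl b2 b3 b4 in blast)+
  qed (use U in blast)
qed

text \<open>With at most one touched ladder the ring is still connected and reaches its own ladder
  on the spine. Otherwise both touched ladders lie in ring \<open>r\<close>, so the ring at the
  other end of the vertical link is entirely intact and serves as a detour.\<close>

lemma blocks_connected:
  assumes sp: "\<And>r. r \<le> 4 \<Longrightarrow> \<exists>s. intact r s \<and> block_conn (r, s) q" and rs: "intact r s"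
  shows "block_conn (r, s) q"
proof -
  have b: "block r s" using rs by (simp add: intact_def)
  show ?thesis
  proof (cases "\<exists>d. \<forall>s. (r, s) \<in> touched \<longrightarrow> s = d")
    case True
    then obtain d where d: "\<And>s. (r, s) \<in> touched \<Longrightarrow> s = d" by blast
    obtain t where "intact r t" "block_conn (r, t) q" using sp[of r] b unfolding block_def by blast
    then show ?thesis using ring_connected[OF d rs] block_conn_trans by blast
  next
    case False
    then obtain d d' where dd: "(r, d) \<in> touched" "(r, d') \<in> touched" "d \<noteq> d'" by metis
    have no: "(vlink r s, t) \<notin> touched" for t
      using touched_two[OF dd(1,2), of "(vlink r s, t)"] dd(3) vlink_neq[OF b] by auto
    have u: "intact (vlink r s) s" using block_vlink[OF b] no by (simp add: intact_def)
    obtain t where "intact (vlink r s) t" "block_conn (vlink r s, t) q"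
      using sp[of "vlink r s"] block_vlink[OF b] unfolding block_def by blast
    moreover have "block_conn (vlink r s, s) (vlink r s, t)" if "intact (vlink r s) t" for t
      by (rule ring_connected[OF _ u that]) (use no in blast)
    ultimately show ?thesis using block_conn_vlink[OF rs u] block_conn_trans by blast
  qed
qed

lemma rprev_neq_rnext: "block r s \<Longrightarrow> rprev r s \<noteq> rnext r s"
  using c_ge by (auto simp: rprev_def rnext_def stride_def block_def split: if_splits)

text \<open>If a touched ladder loses one vertex, it stays connected and keeps two exits; they lead
  to different ladders, of which at most one is touched. If it loses two, every other ladder is
  intact and any exit will do.\<close>

lemma vertex_reaches_untouched:
  assumes x: "block r s" "a < M" "a \<notin> rem r s"
  shows "\<exists>r' s' b. intact r' s' \<and> b < M \<and> conn (r, s, a) (r', s', b)"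
proof (cases "(r, s) \<in> touched")
  case False
  then have "intact r s" using x by (simp add: intact_def)
  then show ?thesis using x(2) conn_refl by blast
next
  case True
  note twist = twist_le[of r s]
  \<comment> \<open>\<open>t e\<close> is the ladder behind the exit \<open>e\<close>.\<close>
  define t where "t e = (if e = 0 then (vlink r s, s) else if e = m + 1 then (r, rprev r s) else (r, rnext r s))" for e
  have leave: "?thesis" if e: "e \<in> {0, m + 1, m + 2 + twist r s}" "e \<notin> rem r s"
    "conn (r, s, a) (r, s, e)" "t e \<notin> touched" for e
  proof -
    have eM: "e < M" using e twist m_pos by auto
    obtain r' s' b where mt: "mate r s e = (r', s', b)" by (metis prod_cases3)
    have te: "t e = (r', s')" using e(1) mt by (auto simp: t_def mate_def split: if_splits)
    note mp = mate_props(1,2)[OF x(1) eM mt]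
    have u: "intact r' s'" using mp e(4) te by (simp add: intact_def)
    then have "conn (r, s, e) (r', s', b)" using intact_rem by (intro conn_mate x eM e mt) auto
    then show ?thesis using u mp e(3) conn_trans by blast
  qed
  have dist: "t e \<noteq> (r, s)" "e \<noteq> e' \<Longrightarrow> t e \<noteq> t e'"
    if "e \<in> {0, m + 1, m + 2 + twist r s}" "e' \<in> {0, m + 1, m + 2 + twist r s}" for e e'
    using that vlink_neq[OF x(1)] rprev_neq[OF x(1)] rnext_neq[OF x(1)] rprev_neq_rnext[OF x(1)] by (auto simp: t_def)
  show ?thesis
  proof (cases "\<exists>d. rem r s \<subseteq> {d}")
    case True
    then obtain d where d: "rem r s \<subseteq> {d}" by blast
    obtain e e' where ee: "e \<in> {0, m + 1, m + 2 + twist r s}" "e' \<in> {0, m + 1, m + 2 + twist r s}" "e \<noteq> e'"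
      "e \<notin> rem r s" "e' \<notin> rem r s"
    proof (cases "d = 0")
      case True
      have "m + 1 \<notin> rem r s" "m + 2 + twist r s \<notin> rem r s" using d True by auto
      then show thesis by (intro that[of "m + 1" "m + 2 + twist r s"]) auto
    next
      case False
      then have 0: "0 \<notin> rem r s" using d by auto
      show thesis
      proof (cases "d = m + 1")
        case True
        then have "m + 2 + twist r s \<notin> rem r s" using d by auto
        then show thesis using 0 by (intro that[of 0 "m + 2 + twist r s"]) auto
      next
        case False
        then have "m + 1 \<notin> rem r s" using d by auto
        then show thesis using 0 by (intro that[of 0 "m + 1"]) auto
      qed
    qed
    have eM: "e < M" "e' < M" using ee twist m_pos by auto
    show ?thesis
    proof (cases "t e \<in> touched")
      case True
      have "t e' \<notin> touched"
      proof
        assume "t e' \<in> touched"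
        from touched_two[OF \<open>(r, s) \<in> touched\<close> True this] show False
          using dist(1)[OF ee(1,2)] dist(1)[OF ee(2,1)] dist(2)[OF ee(1,2,3)] by metis
      qed
      then show ?thesis by (rule leave[OF ee(2,5) block_connected[OF x(1) d x(2,3) eM(2) ee(5)]])
    next
      case False
      then show ?thesis by (rule leave[OF ee(1,4) block_connected[OF x(1) d x(2,3) eM(1) ee(4)]])
    qed
  next
    case False
    have fin: "finite (rem r s)" and c2: "card (rem r s) \<le> 2"
    proof -
      have "rem r s = (\<lambda>a. (r, s, a)) -` X" by (auto simp: rem_def)
      then show "finite (rem r s)" using finite_X by (auto intro!: finite_vimageI simp: inj_on_def)
      have "card ((\<lambda>a. (r, s, a)) ` rem r s) \<le> card X" by (intro card_mono finite_X) (auto simp: rem_def)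
      then show "card (rem r s) \<le> 2" using card_X by (simp add: card_image inj_on_def)
    qed
    obtain y z where yz: "y \<in> rem r s" "z \<in> rem r s" "y \<noteq> z" using False by blast
    have sub: "rem r s = {y, z}" 
      using card_seteq[OF fin, of "{y, z}"] yz c2 by simp
    have X2: "X = {(r, s, y), (r, s, z)}"
      using card_seteq[OF finite_X, of "{(r, s, y), (r, s, z)}"] yz card_X by (auto simp: rem_def)
    have T: "touched = {(r, s)}" using arg_cong[OF X2, of "(`) (\<lambda>(r, s, a). (r, s))"] by (simp add: touched_eq)
    obtain e where e: "e \<in> {0, m + 1, m + 2 + twist r s}" "e \<notin> rem r s" "conn (r, s, a) (r, s, e)"
      using reach_exit[OF x(1) _ x(2,3), of y z] sub by blast
    have "t e \<notin> touched" using dist(1)[OF e(1) e(1)] unfolding T by blast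
    then show ?thesis by (rule leave[OF e])
  qed
qed

lemma all_connected:
  assumes "x \<in> V - X" "y \<in> V - X"
  shows "(x, y) \<in> R\<^sup>*"
proof -
  obtain p where sp: "\<And>r. r \<le> 4 \<Longrightarrow> \<exists>s. intact r s \<and> block_conn (r, s) (1, 2 * p)" by (rule spine) blast
  have "conn z (1, 2 * p, 0)" if z: "z \<in> V - X" for z
  proof -
    obtain r s a where za: "z = (r, s, a)" by (metis prod_cases3)
    then have x: "block r s" "a < M" "a \<notin> rem r s" using z by (auto simp: rem_def)
    obtain r' s' b where b: "intact r' s'" "b < M" "conn (r, s, a) (r', s', b)"
      using vertex_reaches_untouched[OF x] by blast
    have "conn (r', s', b) (r', s', 0)" using intact_conn[OF b(1,2), of 0] by simp
    moreover have "conn (r', s', 0) (1, 2 * p, 0)"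
      using blocks_connected[OF sp b(1)] by (simp add: block_conn_def)
    ultimately show ?thesis using b(3) za conn_trans by blast
  qed
  then have "conn x y" using assms conn_sym conn_trans by blast
  then show ?thesis by (simp add: conn_def)
qed

end

context ladder_wall
begin

lemma vertex_connected_wall: "vertex_connected 3 wall"
  unfolding vertex_connected_def
proof (intro conjI allI impI)
  have "(\<lambda>a. (1, 0, a)) ` {..<M} \<subseteq> V" using c_ge by (auto simp: block_def)
  from card_mono[OF finite_V this] have "M \<le> card V"
    by (simp add: card_image inj_on_def)
  then have V3: "3 < card V" using m_pos by simp
  then show "3 < card (pverts wall)" by simp
  fix X assume X: "X \<subseteq> pverts wall" "card X < 3"
  interpret wall_removal m c X by unfold_locales (use X in auto)
  have "V - X \<noteq> {}"
  proof
    assume "V - X = {}"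
    then have "V \<subseteq> X" by blast
    from card_mono[OF finite_X this] show False using V3 X by simp
  qed
  then show "Digraph_Component.connected (with_proj wall \<restriction> (pverts wall - X))"
    using all_connected by (intro connected_induceI) (simp_all add: R_def)
qed

end

subsection \<open>Drawings on a cylinder\<close>

text \<open>Wraps a cylinder of circumference \<open>N\<close> around the origin. The radius is the
  height plus 1, so that height 0 stays away from the origin, where the angle is lost.\<close>

definition polar :: "real \<Rightarrow> real \<times> real \<Rightarrow> real \<times> real" where
  "polar N z = ((snd z + 1) * cos (2 * pi * fst z / N), (snd z + 1) * sin (2 * pi * fst z / N))"

lemma polar_eqD:
  assumes N: "N > 0" and y: "0 \<le> y" "0 \<le> y'" and eq: "polar N (x, y) = polar N (x', y')"
  shows "y = y'" "\<exists>j::int. x = x' + of_int j * N"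
proof -
  let ?a = "2 * pi * x / N" and ?b = "2 * pi * x' / N"
  have e: "(y + 1) * cos ?a = (y' + 1) * cos ?b" "(y + 1) * sin ?a = (y' + 1) * sin ?b"
    using eq by (simp_all add: polar_def)
  have "(y + 1)\<^sup>2 = ((y + 1) * cos ?a)\<^sup>2 + ((y + 1) * sin ?a)\<^sup>2"
    by (simp add: power_mult_distrib flip: distrib_left)
  also have "\<dots> = (y' + 1)\<^sup>2" unfolding e by (simp add: power_mult_distrib flip: distrib_left)
  finally have "(y + 1)\<^sup>2 = (y' + 1)\<^sup>2" .
  then show yy: "y = y'" using y by (simp add: power2_eq_iff)
  have "cos ?a = cos ?b" "sin ?a = sin ?b" using e y unfolding yy by auto
  then obtain j :: int where "?a = ?b + 2 * pi * j" using sin_cos_eq_iff by metis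
  then have "2 * pi * x = 2 * pi * (x' + of_int j * N)" using N by (simp add: field_simps)
  then show "\<exists>j::int. x = x' + of_int j * N" by auto
qed

lemma polar_periodic:
  assumes "N > 0" shows "polar N (x + of_int j * N, y) = polar N (x, y)"
proof -
  have "2 * pi * (x + of_int j * N) / N = 2 * pi * x / N + 2 * pi * of_int j"
    using assms by (simp add: field_simps)
  moreover have "sin (a + 2 * pi * of_int j) = sin a \<and> cos (a + 2 * pi * of_int j) = cos a" for a
    using sin_cos_eq_iff[of "a + 2 * pi * of_int j" a] by blast
  ultimately show ?thesis by (simp add: polar_def)
qed

section \<open>Straight segments on the cylinder and where they meet\<close>

definition seg_point :: "int \<times> int \<Rightarrow> int \<times> int \<Rightarrow> real \<Rightarrow> real \<times> real" where
  "seg_point p q t = ((1 - t) * of_int (fst p) + t * of_int (fst q), (1 - t) * of_int (snd p) + t * of_int (snd q))"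

lemma seg_point_0 [simp]: "seg_point p q 0 = (of_int (fst p), of_int (snd p))"
  and seg_point_1 [simp]: "seg_point p q 1 = (of_int (fst q), of_int (snd q))"
  by (simp_all add: seg_point_def)

text \<open>
  A drawing on a cylinder of circumference \<open>N\<close>, given by its lift to the plane: vertices are
  lattice points, and every edge is a straight segment that either stays on one horizontal line
  or joins two consecutive ones.
\<close>

locale cylinder_drawing =
  fixes G :: "'a pair_pre_digraph" and N :: int and P :: "'a \<Rightarrow> int \<times> int"
    and LE :: "int \<times> int \<Rightarrow> int \<times> int \<Rightarrow> bool"
  assumes N_pos: "0 < N"
    and wf: "pair_wf_digraph G"
    and height: "u \<in> pverts G \<Longrightarrow> 0 \<le> snd (P u)"
    and inj_P: "u \<in> pverts G \<Longrightarrow> w \<in> pverts G \<Longrightarrow> snd (P u) = snd (P w) \<Longrightarrow>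
      fst (P u) = fst (P w) + j * N \<Longrightarrow> u = w"
    and shape: "LE p q \<Longrightarrow> snd p = snd q \<and> fst p < fst q \<and> fst q < fst p + N \<or> snd q = snd p + 1"
    and shift: "LE p q \<Longrightarrow> LE (fst p + j * N, snd p) (fst q + j * N, snd q)"
    and horizontal: "LE p q \<Longrightarrow> snd p = snd q \<Longrightarrow> u \<in> pverts G \<Longrightarrow> snd (P u) = snd p \<Longrightarrow>
      fst p < fst (P u) + j * N \<Longrightarrow> fst q \<le> fst (P u) + j * N"
    and strip: "LE p q \<Longrightarrow> LE p' q' \<Longrightarrow> snd q = snd p + 1 \<Longrightarrow> snd q' = snd p' + 1 \<Longrightarrow> snd p = snd p' \<Longrightarrow>
      fst p \<le> fst p' \<and> fst q \<le> fst q' \<or> fst p' \<le> fst p \<and> fst q' \<le> fst q"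
    and ends: "LE p q \<Longrightarrow> (\<exists>u\<in>pverts G. \<exists>j. p = (fst (P u) + j * N, snd (P u))) \<and>
      (\<exists>u\<in>pverts G. \<exists>j. q = (fst (P u) + j * N, snd (P u)))"
    and arcs: "(u, w) \<in> parcs G \<Longrightarrow> \<exists>j. LE (P u) (fst (P w) + j * N, snd (P w)) \<or>
      LE (fst (P w) + j * N, snd (P w)) (P u)"
begin

definition lift :: "int \<times> int \<Rightarrow> 'a \<Rightarrow> bool" where
  "lift p u \<longleftrightarrow> u \<in> pverts G \<and> (\<exists>j. p = (fst (P u) + j * N, snd (P u)))"

definition pos :: "'a \<Rightarrow> real \<times> real" where
  "pos u = polar N (of_int (fst (P u)), of_int (snd (P u)))"

definition curve :: "int \<times> int \<Rightarrow> int \<times> int \<Rightarrow> real \<Rightarrow> real \<times> real" where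
  "curve p q = (\<lambda>t. polar N (seg_point p q t))"

lemma rN_pos: "real_of_int N > 0" using N_pos by simp

lemma lift_pos: "lift p u \<Longrightarrow> polar N (of_int (fst p), of_int (snd p)) = pos u"
  using polar_periodic[OF rN_pos] by (auto simp: lift_def pos_def)

lemma lift_inj: "lift p u \<Longrightarrow> lift p w \<Longrightarrow> u = w"
proof -
  assume "lift p u" "lift p w"
  then obtain j j' where "u \<in> pverts G" "w \<in> pverts G" "snd (P u) = snd (P w)"
    "fst (P u) + j * N = fst (P w) + j' * N" by (auto simp: lift_def)
  then show ?thesis using inj_P[of u w "j' - j"] by (simp add: left_diff_distrib)
qed

lemma lift_shift: "lift p u \<Longrightarrow> lift (fst p + j * N, snd p) u"
  by (auto simp: lift_def add.assoc intro!: exI[of _ "_ + j"] simp flip: distrib_right)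

lemma ends_lift: "LE p q \<Longrightarrow> (\<exists>u. lift p u) \<and> (\<exists>u. lift q u)"
  using ends[of p q] by (auto simp: lift_def)

lemma height_seg_point:
  assumes "LE p q" "0 \<le> t" "t \<le> 1" shows "0 \<le> snd (seg_point p q t)"
proof -
  have "0 \<le> snd p" "0 \<le> snd q" using ends[OF assms(1)] height by auto
  then show ?thesis using assms by (simp add: seg_point_def)
qed

lemma between:
  assumes "LE p q" "snd p = snd q" "lift z u" "snd z = snd p"
  shows "fst z \<le> fst p \<or> fst q \<le> fst z"
proof -
  obtain j where j: "u \<in> pverts G" "z = (fst (P u) + j * N, snd (P u))"
    using assms(3) by (auto simp: lift_def)
  then show ?thesis using horizontal[OF assms(1,2) j(1), of j] assms(4) by fastforce
qed

text \<open>Used for segments between consecutive horizontal lines: they have integral height only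
  at their ends, so no vertex and no horizontal edge meets their interior.\<close>

lemma integral_param:
  assumes "(1 - t) * of_int a + t * of_int (a + 1) = real_of_int b" "0 \<le> t" "t \<le> 1"
  shows "t = 0 \<or> t = 1"
proof -
  have "t = of_int (b - a)" using assms by (simp add: algebra_simps)
  then show ?thesis using assms(2,3) by (cases "b - a = 0") (auto simp: of_int_eq_1_iff)
qed

lemma vertex_on_segment:
  assumes pq: "LE p q" and z: "lift z u" and t: "0 \<le> t" "t \<le> 1"
    and eq: "seg_point p q t = (of_int (fst z), of_int (snd z))"
  shows "z = p \<or> z = q"
proof -
  consider (h) "snd p = snd q" "fst p < fst q" | (s) "snd q = snd p + 1" using shape[OF pq] by blast
  then show ?thesis
  proof cases
    case h
    have y: "snd z = snd p" using eq h by (simp add: seg_point_def algebra_simps)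
    have x: "of_int (fst z) = of_int (fst p) + t * (of_int (fst q) - of_int (fst p) :: real)"
      using eq by (simp add: seg_point_def algebra_simps)
    have "t * (of_int (fst q) - of_int (fst p)) \<le> 1 * (of_int (fst q) - of_int (fst p) :: real)"
      using h t by (intro mult_right_mono) auto
    then have "fst z \<le> fst q" using x by (simp flip: of_int_le_iff[where ?'a = real])
    moreover have "0 \<le> t * (of_int (fst q) - of_int (fst p) :: real)" using h t by simp
    then have "fst p \<le> fst z" using x by (simp flip: of_int_le_iff[where ?'a = real])
    ultimately have "fst z = fst p \<or> fst z = fst q" using between[OF pq h(1) z y] by auto
    then show ?thesis using y h by (auto simp: prod_eq_iff)
  next
    case s
    have "t = 0 \<or> t = 1"
      using integral_param[of t "snd p" "snd z"] eq s t by (simp add: seg_point_def)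
    then show ?thesis using eq by (auto simp: prod_eq_iff)
  qed
qed

text \<open>If \<open>t'\<close> is an end, the common point is a vertex, and vertices lie only at
  ends. Overlapping horizontal segments coincide because neither has an end of the other in its
  interior. Segments of different kinds are separated by integrality of heights, and two segments in
  one strip by their left-to-right order.\<close>

lemma segments_meet:
  assumes pq: "LE p q" and pq': "LE p' q'" and t: "0 \<le> t" "t \<le> 1" and t': "0 \<le> t'" "t' \<le> 1"
    and eq: "seg_point p q t = seg_point p' q' t'"
  shows "t = 0 \<or> t = 1 \<or> (p = p' \<and> q = q')"
proof (cases "t' = 0 \<or> t' = 1")
  case True
  obtain u w where "lift p' u" "lift q' w" using ends_lift[OF pq'] by blast
  then have "\<exists>z u. lift z u \<and> seg_point p q t = (of_int (fst z), of_int (snd z))"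
    using True unfolding eq by (elim disjE) (simp_all, blast+)
  then obtain z u where z: "lift z u" "seg_point p q t = (of_int (fst z), of_int (snd z))" by blast
  from vertex_on_segment[OF pq z(1) t z(2)] have zz: "z = p \<or> z = q" .
  show ?thesis
  proof (cases "snd p = snd q")
    case h: True
    then have "fst p < fst q" using shape[OF pq] by auto
    moreover have "(1 - t) * of_int (fst p) + t * of_int (fst q) = (of_int (fst z) :: real)"
      using z(2) by (simp add: seg_point_def)
    ultimately have "t * (of_int (fst q) - of_int (fst p)) = (0::real) \<or>
      (1 - t) * (of_int (fst q) - of_int (fst p)) = (0::real)"
      using zz by (auto simp: algebra_simps)
    then show ?thesis using \<open>fst p < fst q\<close> by auto
  next
    case False
    then show ?thesis using integral_param[of t "snd p" "snd z"] shape[OF pq] z(2) t by (auto simp: seg_point_def)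
  qed
next
  case False
  then have t'01: "0 < t'" "t' < 1" using t' by auto
  show ?thesis
  proof (rule ccontr)
    assume n: "\<not> ?thesis"
    then have t01: "0 < t" "t < 1" using t by auto
    have y: "(1 - t) * of_int (snd p) + t * of_int (snd q) = (1 - t') * of_int (snd p') + t' * (of_int (snd q') :: real)"
      and x: "(1 - t) * of_int (fst p) + t * of_int (fst q) = (1 - t') * of_int (fst p') + t' * (of_int (fst q') :: real)"
      using eq by (auto simp: seg_point_def)
    consider (hh) "snd p = snd q" "snd p' = snd q'" | (hs) "snd p = snd q" "snd q' = snd p' + 1"
      | (translate) "snd q = snd p + 1" "snd p' = snd q'" | (ss) "snd q = snd p + 1" "snd q' = snd p' + 1"
      using shape[OF pq] shape[OF pq'] by blast
    then show False
    proof cases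
      case hh
      have lt: "fst p < fst q" "fst p' < fst q'" using shape[OF pq] shape[OF pq'] hh by auto
      have yy: "snd p = snd p'" using y hh by (simp add: algebra_simps)
      define X where "X = (1 - t) * of_int (fst p) + t * (of_int (fst q) :: real)"
      have convex: "of_int a < (1 - s) * of_int a + s * (of_int b :: real) \<and> (1 - s) * of_int a + s * of_int b < (of_int b :: real)"
        if "0 < s" "s < 1" "a < b" for s and a b :: int
      proof -
        have "0 < s * (of_int b - of_int a :: real)" "0 < (1 - s) * (of_int b - of_int a :: real)"
          using that by simp_all
        then show ?thesis by (simp add: algebra_simps)
      qed
      have X: "of_int (fst p) < X" "X < of_int (fst q)" using convex[OF t01 lt(1)] by (auto simp: X_def)
      have X': "of_int (fst p') < X" "X < of_int (fst q')"
        using convex[OF t'01 lt(2)] x by (auto simp: X_def)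
      have o: "fst p < fst q'" "fst p' < fst q"
        using X X' by (metis less_trans of_int_less_iff)+
      obtain a b a' b' where l: "lift p a" "lift q b" "lift p' a'" "lift q' b'"
        using ends_lift[OF pq] ends_lift[OF pq'] by blast
      have "fst p' \<le> fst p" using between[OF pq hh(1) l(3)] yy o by auto
      moreover have "fst p \<le> fst p'" using between[OF pq' hh(2) l(1)] yy o by auto
      moreover have "fst q \<le> fst q'" using between[OF pq hh(1) l(4)] yy hh o by auto
      moreover have "fst q' \<le> fst q" using between[OF pq' hh(2) l(2)] yy hh o by auto
      ultimately show False using n yy hh by (auto simp: prod_eq_iff)
    next
      case hs
      then have "(1 - t') * of_int (snd p') + t' * of_int (snd p' + 1) = real_of_int (snd p)"
        using y by (simp add: algebra_simps)
      then show False using integral_param t'01 by fastforce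
    next
      case translate
      then have "(1 - t) * of_int (snd p) + t * of_int (snd p + 1) = real_of_int (snd p')"
        using y by (simp add: algebra_simps)
      then show False using integral_param t01 by fastforce
    next
      case ss
      have "t - t' = of_int (snd p' - snd p)" using y ss by (simp add: algebra_simps)
      then have "\<bar>of_int (snd p' - snd p) :: real\<bar> < 1" using t01 t'01 by linarith
      then have yy: "snd p = snd p'" by linarith
      then have tt: "t = t'" using \<open>t - t' = _\<close> by simp
      \<comment> \<open>By \<open>strip\<close> the differences at both ends have the same sign;
        with positive weights they can only sum to 0 if both vanish.\<close>
      have e: "(1 - t) * (of_int (fst p) - of_int (fst p')) + t * (of_int (fst q) - of_int (fst q') :: real) = 0"
        using x unfolding tt by (simp add: algebra_simps)
      have "fst p = fst p' \<and> fst q = fst q'"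
        using strip[OF pq pq' ss yy]
      proof
        assume le: "fst p \<le> fst p' \<and> fst q \<le> fst q'"
        have "(1 - t) * (of_int (fst p) - of_int (fst p')) \<le> (0::real)" "t * (of_int (fst q) - of_int (fst q')) \<le> (0::real)"
          using le t01 by (auto simp: mult_nonneg_nonpos)
        then have "(1 - t) * (of_int (fst p) - of_int (fst p')) = (0::real)" "t * (of_int (fst q) - of_int (fst q')) = (0::real)"
          using e by linarith+
        then show ?thesis using t01 by simp
      next
        assume le: "fst p' \<le> fst p \<and> fst q' \<le> fst q"
        have "(1 - t) * (of_int (fst p) - of_int (fst p')) \<ge> (0::real)" "t * (of_int (fst q) - of_int (fst q')) \<ge> (0::real)"
          using le t01 by auto
        then have "(1 - t) * (of_int (fst p) - of_int (fst p')) = (0::real)" "t * (of_int (fst q) - of_int (fst q')) = (0::real)"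
          using e by linarith+
        then show ?thesis using t01 by simp
      qed
      then show False using n yy ss by (auto simp: prod_eq_iff)
    qed
  qed
qed

lemma seg_point_shift:
  "seg_point (fst p + j * N, snd p) (fst q + j * N, snd q) t = (fst (seg_point p q t) + of_int j * of_int N, snd (seg_point p q t))"
  by (simp add: seg_point_def algebra_simps)

text \<open>A meeting on the cylinder is a meeting in the plane after one segment is translated by a
  multiple of the circumference; \<open>shift\<close> keeps the translate in
  \<open>LE\<close>.\<close>

lemma polar_seg_point_eqD:
  assumes "LE p q" "LE p' q'" "0 \<le> t" "t \<le> 1" "0 \<le> t'" "t' \<le> 1"
    and "polar N (seg_point p q t) = polar N (seg_point p' q' t')"
  obtains j where "LE (fst p' + j * N, snd p') (fst q' + j * N, snd q')"
    "seg_point p q t = seg_point (fst p' + j * N, snd p') (fst q' + j * N, snd q') t'"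
proof -
  note h = height_seg_point[OF assms(1,3,4)] height_seg_point[OF assms(2,5,6)]
  note D = polar_eqD[OF rN_pos h, of "fst (seg_point p q t)" "fst (seg_point p' q' t')"]
  have "snd (seg_point p q t) = snd (seg_point p' q' t')" using D(1) assms(7) by simp
  moreover obtain j :: int where "fst (seg_point p q t) = fst (seg_point p' q' t') + of_int j * of_int N"
    using D(2) assms(7) by auto
  ultimately have "seg_point p q t = seg_point (fst p' + j * N, snd p') (fst q' + j * N, snd q') t'"
    unfolding seg_point_shift by (simp add: prod_eq_iff)
  then show thesis using that shift[OF assms(2)] by blast
qed

text \<open>\<open>polar\<close> identifies two points of a segment only if they have equal height
  and differ by a multiple of \<open>N\<close>. Horizontal segments are shorter than
  \<open>N\<close>, and all others are strictly monotone in height.\<close>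

lemma arc_curve:
  assumes "LE p q" shows "arc (curve p q)"
  unfolding arc_def path_def
proof
  show "continuous_on {0..1} (curve p q)"
    unfolding curve_def polar_def seg_point_def by (intro continuous_intros) (use N_pos in auto)
  show "inj_on (curve p q) {0..1}"
  proof (rule inj_onI)
    fix t t' :: real assume t: "t \<in> {0..1}" "t' \<in> {0..1}" and eq: "curve p q t = curve p q t'"
    obtain j where j: "seg_point p q t = seg_point (fst p + j * N, snd p) (fst q + j * N, snd q) t'"
      by (rule polar_seg_point_eqD[of p q p q t t']) (use assms t eq in \<open>auto simp: curve_def\<close>)
    consider (h) "snd p = snd q" "fst p < fst q" "fst q < fst p + N" | (s) "snd q = snd p + 1"
      using shape[OF assms] by blast
    then show "t = t'"
    proof cases
      case h
      let ?d = "of_int (fst q) - of_int (fst p) :: real"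
      have e: "(t - t') * ?d = of_int j * of_int N"
        using j unfolding seg_point_shift by (simp add: seg_point_def algebra_simps)
      have d: "0 < ?d" "?d < of_int N" using h by linarith+
      have "\<bar>t - t'\<bar> * ?d \<le> 1 * ?d" using t d by (intro mult_right_mono) auto
      moreover have "\<bar>(t - t') * ?d\<bar> = \<bar>t - t'\<bar> * ?d" using d by (simp add: abs_mult)
      ultimately have "\<bar>(t - t') * ?d\<bar> \<le> ?d" by simp
      then have "\<bar>(t - t') * ?d\<bar> < of_int N" using d(2) by (rule le_less_trans)
      then have "\<bar>of_int j * of_int N\<bar> < (of_int N :: real)" unfolding e .
      then have "\<bar>j\<bar> * N < N" using N_pos by (simp add: abs_mult flip: of_int_mult of_int_abs)
      then have "j = 0" using N_pos by simp
      then show ?thesis using e d by auto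
    next
      case s
      then show ?thesis using j unfolding seg_point_shift by (simp add: seg_point_def algebra_simps)
    qed
  qed
qed

lemma planar_drawing: "planar G"
proof -
  \<comment> \<open>An edge is given only by its set of ends, so one of its lifts is chosen. Its
    direction is immaterial, as a drawing compares unordered pairs of ends.\<close>
  define crv where "crv e = (let (p, q) = (SOME (p, q). LE p q \<and> (\<exists>u w. e = {u, w} \<and> lift p u \<and> lift q w)) in curve p q)" for e
  have crv: "\<exists>p q u' w'. LE p q \<and> {u, w} = {u', w'} \<and> lift p u' \<and> lift q w' \<and> crv {u, w} = curve p q"
    if uw: "(u, w) \<in> parcs G" for u w
  proof -
    have V: "u \<in> pverts G" "w \<in> pverts G" using pair_wf_digraph.wellformed'[OF wf uw] by auto
    have lu: "lift (P u) u" using V by (auto simp: lift_def intro: exI[of _ 0])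
    have lw: "lift (fst (P w) + j * N, snd (P w)) w" for j using V by (auto simp: lift_def)
    let ?Q = "\<lambda>(p, q). LE p q \<and> (\<exists>u' w'. {u, w} = {u', w'} \<and> lift p u' \<and> lift q w')"
    have "\<exists>x. ?Q x"
      using arcs[OF uw]
    proof (elim exE disjE)
      fix j assume "LE (P u) (fst (P w) + j * N, snd (P w))"
      then show ?thesis using lu lw by (intro exI[of _ "(P u, (fst (P w) + j * N, snd (P w)))"]) auto
    next
      fix j assume "LE (fst (P w) + j * N, snd (P w)) (P u)"
      then show ?thesis using lu lw
        by (intro exI[of _ "((fst (P w) + j * N, snd (P w)), P u)"]) (auto simp: insert_commute)
    qed
    then have "?Q (SOME x. ?Q x)" by (rule someI_ex)
    moreover obtain p q where pq: "(SOME x. ?Q x) = (p, q)" by (rule prod.exhaust)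
    ultimately have "?Q (p, q)" by simp
    moreover have "crv {u, w} = curve p q" unfolding crv_def pq by simp
    ultimately show ?thesis unfolding prod.case by blast
  qed
  have "plane_drawing G pos crv"
  proof (rule plane_drawingI)
    show "inj_on pos (pverts G)"
    proof (rule inj_onI)
      fix u w assume V: "u \<in> pverts G" "w \<in> pverts G" and eq: "pos u = pos w"
      note D = polar_eqD[OF rN_pos _ _ eq[unfolded pos_def]]
      have h: "0 \<le> real_of_int (snd (P u))" "0 \<le> real_of_int (snd (P w))" using V height by auto
      have "snd (P u) = snd (P w)" using D(1)[OF h] by simp
      moreover obtain j :: int where "real_of_int (fst (P u)) = of_int (fst (P w)) + of_int j * of_int N"
        using D(2)[OF h] by blast
      then have "fst (P u) = fst (P w) + j * N" by (simp flip: of_int_mult of_int_add)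
      ultimately show "u = w" using inj_P V by blast
    qed
  next
    fix u w assume uw: "(u, w) \<in> parcs G"
    obtain p q u' w' where c: "LE p q" "{u, w} = {u', w'}" "lift p u'" "lift q w'" "crv {u, w} = curve p q"
      using crv[OF uw] by blast
    show "arc (crv {u, w})" unfolding c(5) using arc_curve[OF c(1)] .
    have "{pathstart (curve p q), pathfinish (curve p q)} = pos ` {u', w'}"
      using lift_pos[OF c(3)] lift_pos[OF c(4)] by (simp add: curve_def pathstart_def pathfinish_def)
    also have "\<dots> = pos ` {u, w}" using c(2) by simp
    finally show "{pathstart (crv {u, w}), pathfinish (crv {u, w})} = {pos u, pos w}" unfolding c(5) by simp
    fix z assume z: "z \<in> pverts G" "pos z \<in> path_image (crv {u, w})"
    obtain t where t: "0 \<le> t" "t \<le> 1" "pos z = polar N (seg_point p q t)"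
      using z(2) unfolding c(5) by (auto simp: path_image_def curve_def)
    have h: "0 \<le> real_of_int (snd (P z))" "0 \<le> snd (seg_point p q t)" using z height height_seg_point[OF c(1) t(1,2)] by auto
    note D = polar_eqD[OF rN_pos h(2,1), of "fst (seg_point p q t)" "of_int (fst (P z))"]
    have eq: "polar N (fst (seg_point p q t), snd (seg_point p q t)) = polar N (of_int (fst (P z)), of_int (snd (P z)))"
      using t(3) by (simp add: pos_def)
    obtain j :: int where j: "fst (seg_point p q t) = of_int (fst (P z)) + of_int j * of_int N" using D(2)[OF eq] by blast
    let ?z = "(fst (P z) + j * N, snd (P z))"
    have lz: "lift ?z z" using z by (auto simp: lift_def)
    have "?z = p \<or> ?z = q"
      by (rule vertex_on_segment[OF c(1) lz t(1,2)]) (use j D(1)[OF eq] in \<open>simp add: prod_eq_iff\<close>)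
    then have "z = u' \<or> z = w'" using lz c(3,4) lift_inj by metis
    then show "pos z = pos u \<or> pos z = pos w" using c(2) by (metis doubleton_eq_iff)
  next
    fix u w x y z
    assume uw: "(u, w) \<in> parcs G" and xy: "(x, y) \<in> parcs G" and ne: "{x, y} \<noteq> {u, w}"
      and z: "z \<in> path_image (crv {u, w})" "z \<in> path_image (crv {x, y})"
    obtain p q u' w' where c: "LE p q" "{u, w} = {u', w'}" "lift p u'" "lift q w'" "crv {u, w} = curve p q"
      using crv[OF uw] by blast
    obtain p2 q2 x' y' where c2: "LE p2 q2" "{x, y} = {x', y'}" "lift p2 x'" "lift q2 y'" "crv {x, y} = curve p2 q2"
      using crv[OF xy] by blast
    obtain t where t: "0 \<le> t" "t \<le> 1" "z = polar N (seg_point p q t)"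
      using z(1) unfolding c(5) by (auto simp: path_image_def curve_def)
    obtain t' where t': "0 \<le> t'" "t' \<le> 1" "z = polar N (seg_point p2 q2 t')"
      using z(2) unfolding c2(5) by (auto simp: path_image_def curve_def)
    obtain j where j: "LE (fst p2 + j * N, snd p2) (fst q2 + j * N, snd q2)"
      "seg_point p q t = seg_point (fst p2 + j * N, snd p2) (fst q2 + j * N, snd q2) t'"
      by (rule polar_seg_point_eqD[OF c(1) c2(1) t(1,2) t'(1,2)]) (use t t' in auto)
    have "\<not> (p = (fst p2 + j * N, snd p2) \<and> q = (fst q2 + j * N, snd q2))"
    proof
      assume "p = (fst p2 + j * N, snd p2) \<and> q = (fst q2 + j * N, snd q2)"
      then have "lift p x'" "lift q y'" using lift_shift c2(3,4) by metis+
      then have "x' = u'" "y' = w'" using lift_inj c(3,4) by blast+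
      then show False using ne c(2) c2(2) by simp
    qed
    then have "t = 0 \<or> t = 1" using segments_meet[OF c(1) j(1) t(1,2) t'(1,2) j(2)] by blast
    then have "z = pos u' \<or> z = pos w'"
      using t(3) lift_pos[OF c(3)] lift_pos[OF c(4)] by auto
    then show "z = pos u \<or> z = pos w" using c(2) by (metis doubleton_eq_iff)
  qed
  then show ?thesis by (auto simp: planar_def)
qed

end

subsection \<open>Planarity of the wall\<close>

context ladder_wall
begin

text \<open>The lift unrolls the cylinder, so slots become arbitrary integers; the period
  \<open>2 * c\<close> is even and preserves the parities involved.\<close>

definition twist_int :: "nat \<Rightarrow> int \<Rightarrow> nat" where
  "twist_int r s = (if r = 1 \<and> odd s \<or> r = 3 \<and> even s then 1 else 0)"

text \<open>The direction in which \<open>vlink\<close> leaves the ring, so that linked ladders grow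
  towards each other.\<close>

definition side :: "nat \<Rightarrow> int \<Rightarrow> int" where
  "side r s = (if even (int r + s) then 1 else - 1)"

text \<open>The rails run at offsets 0 and 1. In a twisted ladder the right exit
  \<open>m + 3\<close> is pushed out to offset 2, level with \<open>m + 2\<close>, so that the rung
  from \<open>m\<close> to \<open>m + 2\<close> is horizontal and the path
  \<open>m + 1, m + 2, m + 3\<close> lies below it or at its height.\<close>

definition xoff :: "nat \<Rightarrow> nat \<Rightarrow> int" where
  "xoff d a = (if a \<le> m + 1 then 0 else if d = 1 \<and> a = m + 3 then 2 else 1)"

definition yoff :: "nat \<Rightarrow> nat \<Rightarrow> int" where
  "yoff d a = (if a \<le> m + 1 then int m + 1 - int a else if d = 1 \<and> a = m + 2 then 1 else int a - int m - 2)"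

text \<open>Two facing ladders extend \<open>m + 1\<close> from their rings; the distance
  \<open>2 * (m + 1) + 1\<close> leaves a strip of height 1 for the link between them.\<close>

abbreviation MM :: int where "MM \<equiv> 2 * int m + 3"

text \<open>
  In the lift of the drawing the slot \<open>s\<close> occupies the abscissas \<open>3 * s\<close> to \<open>3 * s + 2\<close>, and ring \<open>r\<close>
  lies at height \<open>r * MM\<close>; a ladder grows upwards or downwards from its ring, with the vertical exit
  at distance \<open>m + 1\<close>.
\<close>

definition P :: "nat \<times> nat \<times> nat \<Rightarrow> int \<times> int" where
  "P = (\<lambda>(r, s, a). (3 * int s + xoff (twist r s) a, int r * MM + side r (int s) * yoff (twist r s) a))"

definition strip_edge :: "nat \<Rightarrow> int \<Rightarrow> int \<Rightarrow> int \<Rightarrow> bool" where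
  "strip_edge d y lo up \<longleftrightarrow> lo = 0 \<and> up = 0 \<or>
    y \<le> int m \<and> lo = (if d = 1 then (if y = 0 then 0 else if y = 1 then 2 else 1) else 1) \<and>
      up = (if y = int m then 0 else 1) \<or>
    d = 1 \<and> y = 0 \<and> lo = 3 \<and> up = 2"

text \<open>
  \<open>strip_edge d y lo up\<close>: some edge of a ladder runs from offset \<open>lo\<close> at distance \<open>y\<close> from the ring to
  offset \<open>up\<close> at distance \<open>y + 1\<close>. The pair \<open>(3, 2)\<close> is the ring edge at the right exit of a twisted ladder,
  and \<open>y = m + 1\<close> accounts for the edges between rings.
\<close>

definition hor_edge :: "int \<times> int \<Rightarrow> int \<times> int \<Rightarrow> bool" where
  "hor_edge p q \<longleftrightarrow> snd p = snd q \<and> (fst q = fst p + 1 \<or>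
    (\<exists>r s. r \<le> 4 \<and> (r = 0 \<longrightarrow> even s) \<and> (r = 4 \<longrightarrow> odd s) \<and>
      snd p = int r * MM \<and> fst p = 3 * s + 1 \<and> fst q = 3 * (s + int (stride r))))"

text \<open>In a ladder growing downwards \<open>y = m + 1\<close> is excluded: the strip of a link
  is attributed to the lower ring only, which makes ring and \<open>y\<close> recoverable from the
  height.\<close>

definition ver_edge :: "int \<times> int \<Rightarrow> int \<times> int \<Rightarrow> bool" where
  "ver_edge p q \<longleftrightarrow> (\<exists>r s y lo up. 0 \<le> y \<and> y \<le> int m + 1 \<and> strip_edge (twist_int r s) y lo up \<and>
    (side r s = 1 \<and> p = (3 * s + lo, int r * MM + y) \<and> q = (3 * s + up, int r * MM + y + 1) \<or>
     side r s = - 1 \<and> y \<le> int m \<and> p = (3 * s + up, int r * MM - y - 1) \<and> q = (3 * s + lo, int r * MM - y)))"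

definition translate :: "int \<Rightarrow> int \<times> int \<Rightarrow> int \<times> int" where
  "translate j p = (fst p + j * (6 * int c), snd p)"

text \<open>A drawing only requires that these segments cover all edges and do not cross. The
  conditions on the ends discard segments that do not join lifted vertices.\<close>

definition LE :: "int \<times> int \<Rightarrow> int \<times> int \<Rightarrow> bool" where
  "LE p q \<longleftrightarrow> (hor_edge p q \<or> ver_edge p q) \<and> (\<exists>u\<in>V. \<exists>j. p = translate j (P u)) \<and> (\<exists>u\<in>V. \<exists>j. q = translate j (P u))"

lemma translate_translate: "translate i (translate j p) = translate (i + j) p" and translate_0 [simp]: "translate 0 p = p"
  by (simp_all add: translate_def algebra_simps)

lemma twist_int_int: "twist_int r (int s) = twist r s" by (simp add: twist_int_def twist_def)

lemma side_cases: "side r s = 1 \<or> side r s = - 1" by (simp add: side_def)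

lemma yoff_bounds: "a < M \<Longrightarrow> 0 \<le> yoff d a \<and> yoff d a \<le> int m + 1"
  using m_pos by (auto simp: yoff_def)

lemma xoff_bounds: "0 \<le> xoff d a \<and> xoff d a \<le> 2" by (simp add: xoff_def)

text \<open>\<open>MM\<close> exceeds twice \<open>m + 1\<close>, so the bands around different
  rings are disjoint.\<close>

lemma decode:
  assumes "int r * MM + e = int r' * MM + e'" "\<bar>e\<bar> \<le> int m + 1" "\<bar>e'\<bar> \<le> int m + 1"
  shows "r = r' \<and> e = e'"
proof -
  have *: "int b * MM \<ge> int a * MM + MM" if "a < b" for a b :: nat
  proof -
    have "(int a + 1) * MM \<le> int b * MM" using that by (intro mult_right_mono) auto
    then show ?thesis by (simp add: algebra_simps)
  qed
  have "r = r'" using *[of r r'] *[of r' r] assms by (cases r r' rule: linorder_cases) auto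
  then show ?thesis using assms by simp
qed

lemma P_simp: "P (r, s, a) = (3 * int s + xoff (twist r s) a, int r * MM + side r (int s) * yoff (twist r s) a)"
  by (simp add: P_def)

lemma side_yoff_bound: "a < M \<Longrightarrow> \<bar>side r s * yoff d a\<bar> \<le> int m + 1"
  using yoff_bounds[of a d] side_cases[of r s] by auto

lemma P_height: "u \<in> V \<Longrightarrow> 0 \<le> snd (P u)"
proof -
  assume "u \<in> V"
  then obtain r s a where u: "u = (r, s, a)" "block r s" "a < M" by (auto simp: V_def)
  show ?thesis
  proof (cases "r = 0")
    case True
    then have "side r (int s) = 1" using u by (simp add: block_def side_def)
    then show ?thesis using True yoff_bounds[OF u(3)] by (simp add: u P_simp)
  next
    case False
    then have *: "1 * MM \<le> int r * MM" by (intro mult_right_mono) auto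
    have "0 \<le> x + y" if "1 * MM \<le> x" "\<bar>y\<bar> \<le> int m + 1" for x y :: int
      using that by auto
    from this[OF * side_yoff_bound[OF u(3)]] show ?thesis unfolding u P_simp snd_conv .
  qed
qed

lemma xoff_yoff_inj:
  "\<lbrakk>d \<le> 1; a < M; b < M; xoff d a = xoff d b; yoff d a = yoff d b\<rbrakk> \<Longrightarrow> a = b"
  using m_pos by (auto simp: xoff_def yoff_def split: if_splits)

lemma P_inj:
  assumes "u \<in> V" "w \<in> V" "snd (P u) = snd (P w)" "fst (P u) = fst (P w) + j * (6 * int c)"
  shows "u = w"
proof -
  obtain r s a where u: "u = (r, s, a)" "block r s" "a < M" using assms(1) by (auto simp: V_def)
  obtain r' s' b where w: "w = (r', s', b)" "block r' s'" "b < M" using assms(2) by (auto simp: V_def)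
  have d: "r = r'" "side r (int s) * yoff (twist r s) a = side r' (int s') * yoff (twist r' s') b"
    using decode[of r _ r'] assms(3) side_yoff_bound[OF u(3)] side_yoff_bound[OF w(3)]
    unfolding u(1) w(1) P_simp snd_conv by blast+
  define S where "S = int s' + 2 * int c * j"
  have e: "3 * int s + xoff (twist r s) a = 3 * S + xoff (twist r' s') b"
    using assms(4) unfolding u(1) w(1) P_simp S_def by (simp add: algebra_simps)
  \<comment> \<open>Offsets are at most 2 and slots are 3 apart, so the abscissa determines the
    slot.\<close>
  then have S: "int s = S" using xoff_bounds[of "twist r s" a] xoff_bounds[of "twist r' s'" b] by linarith
  have "s < 2 * c" "s' < 2 * c" using u w by (auto simp: block_def)
  then have "\<bar>S - int s'\<bar> < 2 * int c" using S by linarith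
  then have "\<bar>2 * int c * j\<bar> < 2 * int c" by (simp add: S_def)
  then have "j = 0" using c_ge by (simp add: abs_mult)
  then have s: "s = s'" using S by (simp add: S_def)
  then have "xoff (twist r s) a = xoff (twist r s) b" "yoff (twist r s) a = yoff (twist r s) b"
    using e S d side_cases[of r "int s"] by auto
  then have "a = b" using xoff_yoff_inj[OF twist_le u(3) w(3)] by blast
  then show ?thesis using u w d s by simp
qed

section \<open>Position of the segments relative to each other\<close>

lemma ver_edge_shape: "ver_edge p q \<Longrightarrow> snd q = snd p + 1"
  by (auto simp: ver_edge_def)

lemma hor_edge_shape: "hor_edge p q \<Longrightarrow> snd p = snd q \<and> fst p < fst q \<and> fst q < fst p + 6 * int c"
  using c_ge by (auto simp: hor_edge_def stride_def split: if_splits)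

lemma twist_int_shift: "twist_int r (s + 2 * int c * j) = twist_int r s" and side_shift: "side r (s + 2 * int c * j) = side r s"
  by (simp_all add: twist_int_def side_def)

lemma hor_edge_shift: "hor_edge p q \<Longrightarrow> hor_edge (translate j p) (translate j q)"
  unfolding hor_edge_def translate_def
proof (elim conjE disjE exE)
  fix r s assume *: "snd p = snd q" "r \<le> 4" "r = 0 \<longrightarrow> even s" "r = 4 \<longrightarrow> odd s"
    "snd p = int r * MM" "fst p = 3 * s + 1" "fst q = 3 * (s + int (stride r))"
  show "snd (fst p + j * (6 * int c), snd p) = snd (fst q + j * (6 * int c), snd q) \<and>
    (fst (fst q + j * (6 * int c), snd q) = fst (fst p + j * (6 * int c), snd p) + 1 \<or>
     (\<exists>r s. r \<le> 4 \<and> (r = 0 \<longrightarrow> even s) \<and> (r = 4 \<longrightarrow> odd s) \<and>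
      snd (fst p + j * (6 * int c), snd p) = int r * MM \<and>
      fst (fst p + j * (6 * int c), snd p) = 3 * s + 1 \<and>
      fst (fst q + j * (6 * int c), snd q) = 3 * (s + int (stride r))))"
    using * by (intro conjI disjI2 exI[of _ r] exI[of _ "s + 2 * int c * j"]) (auto simp: algebra_simps)
qed simp

lemma ver_edge_shift: "ver_edge p q \<Longrightarrow> ver_edge (translate j p) (translate j q)"
  unfolding ver_edge_def
proof (elim exE conjE)
  fix r s y lo up
  assume *: "0 \<le> y" "y \<le> int m + 1" "strip_edge (twist_int r s) y lo up"
    "side r s = 1 \<and> p = (3 * s + lo, int r * MM + y) \<and> q = (3 * s + up, int r * MM + y + 1) \<or>
     side r s = - 1 \<and> y \<le> int m \<and> p = (3 * s + up, int r * MM - y - 1) \<and> q = (3 * s + lo, int r * MM - y)"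
  let ?s = "s + 2 * int c * j"
  have "side r ?s = 1 \<and> translate j p = (3 * ?s + lo, int r * MM + y) \<and> translate j q = (3 * ?s + up, int r * MM + y + 1) \<or>
     side r ?s = - 1 \<and> y \<le> int m \<and> translate j p = (3 * ?s + up, int r * MM - y - 1) \<and> translate j q = (3 * ?s + lo, int r * MM - y)"
    using *(4) unfolding side_shift by (auto simp: translate_def algebra_simps)
  then show "\<exists>r s y lo up. 0 \<le> y \<and> y \<le> int m + 1 \<and> strip_edge (twist_int r s) y lo up \<and>
    (side r s = 1 \<and> translate j p = (3 * s + lo, int r * MM + y) \<and> translate j q = (3 * s + up, int r * MM + y + 1) \<or>
     side r s = - 1 \<and> y \<le> int m \<and> translate j p = (3 * s + up, int r * MM - y - 1) \<and> translate j q = (3 * s + lo, int r * MM - y))"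
    using *(1-3) twist_int_shift[of r s j] by metis
qed

lemma hor_edge_between:
  assumes "hor_edge p q" "u \<in> V" "snd (P u) = snd p" "fst p < fst (P u) + j * (6 * int c)"
  shows "fst q \<le> fst (P u) + j * (6 * int c)"
proof (cases "fst q = fst p + 1")
  case False
  then obtain r s where rs: "r \<le> 4" "r = 0 \<longrightarrow> even s" "r = 4 \<longrightarrow> odd s"
    "snd p = int r * MM" "fst p = 3 * s + 1" "fst q = 3 * (s + int (stride r))"
    using assms(1) unfolding hor_edge_def by blast
  obtain r' s' a where u: "u = (r', s', a)" "block r' s'" "a < M" using assms(2) by (auto simp: V_def)
  have "int r' * MM + side r' (int s') * yoff (twist r' s') a = int r * MM + 0"
    using assms(3) rs(4) by (simp add: u P_simp)
  from decode[OF this] have r: "r' = r" "yoff (twist r' s') a = 0"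
    using side_yoff_bound[OF u(3)] side_cases[of r' "int s'"] by auto
  have xoff: "0 \<le> xoff (twist r' s') a" "xoff (twist r' s') a \<le> 1" using r(2) m_pos by (auto simp: xoff_def yoff_def split: if_splits)
  define S where "S = int s' + 2 * int c * j"
  have f: "fst (P u) + j * (6 * int c) = 3 * S + xoff (twist r' s') a"
    by (simp add: u P_simp S_def algebra_simps)
  then have "s < S" using assms(4) rs(5) xoff by linarith
  then have "s + int (stride r) \<le> S"
  proof (cases "r = 0 \<or> r = 4")
    case True
    \<comment> \<open>A ring edge of an end ring passes over slot \<open>s + 1\<close>, which is
      unoccupied for reasons of parity.\<close>
    then have "even S \<longleftrightarrow> even s" using rs u(2) r by (auto simp: block_def S_def)
    then have "S \<noteq> s + 1" by auto
    then show ?thesis using True \<open>s < S\<close> by (auto simp: stride_def)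
  qed (auto simp: stride_def)
  then have "3 * (s + int (stride r)) \<le> 3 * S" by simp
  also have "\<dots> \<le> 3 * S + xoff (twist r' s') a" using xoff by simp
  finally show ?thesis unfolding f rs(6) .
qed (use assms(4) in linarith)

lemma strip_edge_bounds: "strip_edge d y lo up \<Longrightarrow> 0 \<le> lo \<and> lo \<le> 3 \<and> 0 \<le> up \<and> up \<le> 3"
  by (auto simp: strip_edge_def split: if_splits)

lemma strip_edge_chain:
  assumes "strip_edge d y lo up" "strip_edge d y lo' up'"
  shows "lo \<le> lo' \<and> up \<le> up' \<or> lo' \<le> lo \<and> up' \<le> up"
  using assms m_pos by (auto simp: strip_edge_def split: if_splits)

lemma ver_edge_chain:
  assumes "ver_edge p q" "ver_edge p' q'" "snd p = snd p'"
  shows "fst p \<le> fst p' \<and> fst q \<le> fst q' \<or> fst p' \<le> fst p \<and> fst q' \<le> fst q"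
proof -
  obtain r s y lo up where A: "0 \<le> y" "y \<le> int m + 1" "strip_edge (twist_int r s) y lo up"
    "side r s = 1 \<and> p = (3 * s + lo, int r * MM + y) \<and> q = (3 * s + up, int r * MM + y + 1) \<or>
     side r s = - 1 \<and> y \<le> int m \<and> p = (3 * s + up, int r * MM - y - 1) \<and> q = (3 * s + lo, int r * MM - y)"
    using assms(1) unfolding ver_edge_def by blast
  obtain r' s' y' lo' up' where B: "0 \<le> y'" "y' \<le> int m + 1" "strip_edge (twist_int r' s') y' lo' up'"
    "side r' s' = 1 \<and> p' = (3 * s' + lo', int r' * MM + y') \<and> q' = (3 * s' + up', int r' * MM + y' + 1) \<or>
     side r' s' = - 1 \<and> y' \<le> int m \<and> p' = (3 * s' + up', int r' * MM - y' - 1) \<and> q' = (3 * s' + lo', int r' * MM - y')"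
    using assms(2) unfolding ver_edge_def by blast
  \<comment> \<open>The height of the lower border of the strip relative to its ring; in a ladder
    growing downwards, strip \<open>y\<close> runs from \<open>- y - 1\<close> to
    \<open>- y\<close>.\<close>
  define e where "e = (if side r s = 1 then y else - y - 1)"
  define e' where "e' = (if side r' s' = 1 then y' else - y' - 1)"
  have "int r * MM + e = snd p" using A(4) by (auto simp: e_def)
  moreover have "int r' * MM + e' = snd p'" using B(4) by (auto simp: e'_def)
  ultimately have "int r * MM + e = int r' * MM + e'" using assms(3) by simp
  moreover have "\<bar>e\<bar> \<le> int m + 1" "\<bar>e'\<bar> \<le> int m + 1" using A B by (auto simp: e_def e'_def)
  ultimately have re: "r = r'" "e = e'" using decode by blast+
  have sy: "side r s = side r' s'" "y = y'"
    using re(2) A(1) B(1) side_cases[of r s] side_cases[of r' s'] by (auto simp: e_def e'_def split: if_splits)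
  note b = strip_edge_bounds[OF A(3)] strip_edge_bounds[OF B(3)]
  have x: "fst p = 3 * s + (if side r s = 1 then lo else up)" "fst q = 3 * s + (if side r s = 1 then up else lo)"
    "fst p' = 3 * s' + (if side r s = 1 then lo' else up')" "fst q' = 3 * s' + (if side r s = 1 then up' else lo')"
    using A(4) B(4) sy(1) by auto
  \<comment> \<open>Offsets lie between 0 and 3, so different slots share at most the border line
    between them.\<close>
  consider "s + 1 \<le> s'" | "s' + 1 \<le> s" | "s = s'" by linarith
  then show ?thesis
  proof cases
    case 3
    then have "lo \<le> lo' \<and> up \<le> up' \<or> lo' \<le> lo \<and> up' \<le> up"
      using strip_edge_chain[OF A(3)] B(3) re(1) sy by simp
    then show ?thesis unfolding x using 3 by auto
  qed (unfold x, use b in auto)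
qed

section \<open>Every edge of the wall is covered by a segment\<close>

definition joined :: "int \<times> int \<Rightarrow> int \<times> int \<Rightarrow> bool" where
  "joined p q \<longleftrightarrow> hor_edge p q \<or> ver_edge p q \<or> hor_edge q p \<or> ver_edge q p"

lemma joined_strip:
  assumes "0 \<le> y" "y \<le> int m" "strip_edge (twist r s) y lo up"
  shows "joined (3 * int s + lo, int r * MM + side r (int s) * y) (3 * int s + up, int r * MM + side r (int s) * (y + 1))"
proof -
  have strip_edge: "strip_edge (twist_int r (int s)) y lo up" using assms(3) by (simp add: twist_int_int)
  consider "side r (int s) = 1" | "side r (int s) = - 1" using side_cases by blast
  then show ?thesis
  proof cases
    case 1
    then have "ver_edge (3 * int s + lo, int r * MM + y) (3 * int s + up, int r * MM + y + 1)"
      unfolding ver_edge_def using assms strip_edge by (intro exI[of _ r] exI[of _ "int s"] exI[of _ y] exI[of _ lo] exI[of _ up]) auto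
    then show ?thesis using 1 by (simp add: joined_def add.assoc)
  next
    case 2
    then have "ver_edge (3 * int s + up, int r * MM - y - 1) (3 * int s + lo, int r * MM - y)"
      unfolding ver_edge_def using assms strip_edge by (intro exI[of _ r] exI[of _ "int s"] exI[of _ y] exI[of _ lo] exI[of _ up]) auto
    then show ?thesis using 2 by (simp add: joined_def algebra_simps)
  qed
qed

lemma joined_strip':
  assumes "0 \<le> y" "y \<le> int m" "strip_edge (twist r s) y lo up"
    "xoff (twist r s) a = lo" "yoff (twist r s) a = y" "xoff (twist r s) b = up" "yoff (twist r s) b = y + 1"
  shows "joined (P (r, s, a)) (P (r, s, b))" "joined (P (r, s, b)) (P (r, s, a))"
  using joined_strip[OF assms(1-3)] unfolding P_simp assms(4-) by (auto simp: joined_def)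

lemma joined_unit:
  assumes "xoff (twist r s) b = xoff (twist r s) a + 1" "yoff (twist r s) a = yoff (twist r s) b"
  shows "joined (P (r, s, a)) (P (r, s, b))"
  using assms by (simp add: joined_def hor_edge_def P_simp)

lemma joined_csucc:
  assumes "a < M" shows "joined (P (r, s, a)) (P (r, s, csucc a))"
proof -
  have "twist r s = 0 \<or> twist r s = 1" using twist_le[of r s] by linarith
  then consider (left) "a \<le> m" | (rung) "a = m + 1" "twist r s = 0" | (diag) "a = m + 1" "twist r s = 1"
    | (unit) "a = m + 2" "twist r s = 1" | (right) "m + 2 + twist r s \<le> a"
    by fastforce
  then show ?thesis
  proof cases
    case left
    then show ?thesis
      by (intro joined_strip'(2)[of "int m - int a" _ _ 0 0]) (auto simp: strip_edge_def xoff_def yoff_def csucc_def)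
  next
    case rung
    then show ?thesis using m_pos by (intro joined_unit) (auto simp: xoff_def yoff_def csucc_def)
  next
    case diag
    then show ?thesis using m_pos
      by (intro joined_strip'(1)[of 0 _ _ 0 1]) (auto simp: strip_edge_def xoff_def yoff_def csucc_def)
  next
    case unit
    then show ?thesis using m_pos by (intro joined_unit) (auto simp: xoff_def yoff_def csucc_def)
  next
    case right
    then show ?thesis using assms m_pos twist_le[of r s]
      by (intro joined_strip'(1)[of "int a - int m - 2" _ _ "xoff (twist r s) a" "xoff (twist r s) (csucc a)"])
        (auto simp: strip_edge_def xoff_def yoff_def csucc_def split: if_splits)
  qed
qed

lemma joined_chord:
  assumes "0 < a" "a \<le> m" shows "joined (P (r, s, a)) (P (r, s, chord (twist r s) a))"
  using assms twist_le[of r s] by (intro joined_unit) (auto simp: xoff_def yoff_def chord_def split: if_splits)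

lemma joined_ring:
  assumes "block r s"
  shows "\<exists>j. joined (P (r, s, m + 2 + twist r s)) (translate j (P (r, rnext r s, m + 1)))"
proof -
  obtain j :: int where j: "int (rnext r s) + 2 * int c * j = int s + int (stride r)"
  proof (cases "s + stride r < 2 * c")
    case True then show ?thesis using that[of 0] by (simp add: rnext_def)
  next
    case False then show ?thesis using that[of 1] by (simp add: rnext_def of_nat_diff)
  qed
  have q: "translate j (P (r, rnext r s, m + 1)) = (3 * (int s + int (stride r)), int r * MM)"
    unfolding j[symmetric] by (simp add: translate_def P_simp xoff_def yoff_def algebra_simps)
  have "twist r s = 0 \<or> twist r s = 1" using twist_le[of r s] by linarith
  then show ?thesis
  proof
    assume t: "twist r s = 0"
    have "hor_edge (P (r, s, m + 2 + twist r s)) (translate j (P (r, rnext r s, m + 1)))"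
      unfolding q hor_edge_def using assms t
      by (intro conjI disjI2 exI[of _ r] exI[of _ "int s"]) (auto simp: block_def P_simp xoff_def yoff_def)
    then show ?thesis by (auto simp: joined_def)
  next
    assume t: "twist r s = 1"
    then have "r = 1 \<or> r = 3" unfolding twist_def by (metis zero_neq_one)
    then have st: "stride r = 1" unfolding stride_def by (elim disjE) simp_all
    have "joined (3 * int s + 3, int r * MM + side r (int s) * 0) (3 * int s + 2, int r * MM + side r (int s) * (0 + 1))"
      by (rule joined_strip) (auto simp: strip_edge_def t)
    moreover have "P (r, s, m + 2 + twist r s) = (3 * int s + 2, int r * MM + side r (int s) * (0 + 1))"
      using t by (simp add: P_simp xoff_def yoff_def)
    moreover have "translate j (P (r, rnext r s, m + 1)) = (3 * int s + 3, int r * MM + side r (int s) * 0)"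
      unfolding q st by simp
    ultimately have "joined (P (r, s, m + 2 + twist r s)) (translate j (P (r, rnext r s, m + 1)))"
      by (simp only: joined_def) blast
    then show ?thesis by blast
  qed
qed

lemma joined_vertical:
  assumes "even (r + s)" shows "joined (P (r, s, 0)) (P (r + 1, s, 0))"
proof -
  have "side r (int s) = 1" "side (r + 1) (int s) = - 1" using assms by (auto simp: side_def)
  then have "ver_edge (P (r, s, 0)) (P (r + 1, s, 0))"
    unfolding ver_edge_def
    by (intro exI[of _ r] exI[of _ "int s"] exI[of _ "int m + 1"] exI[of _ 0])
      (auto simp: strip_edge_def P_simp xoff_def yoff_def algebra_simps)
  then show ?thesis by (simp add: joined_def)
qed

lemma joined_sym: "joined p q \<Longrightarrow> joined q p" by (auto simp: joined_def)

lemma joined_shift: "joined p q \<Longrightarrow> joined (translate j p) (translate j q)"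
  using hor_edge_shift ver_edge_shift unfolding joined_def by blast

lemma joined_arc:
  assumes "u \<in> V" "w \<in> nbrs u"
  shows "\<exists>j. joined (P u) (translate j (P w))"
proof -
  obtain r s a where u: "u = (r, s, a)" "block r s" "a < M" using assms(1) by (auto simp: V_def)
  have j0: "\<exists>j. joined (P u) (translate j (P w))" if "joined (P u) (P w)"
    using that by (intro exI[of _ 0]) simp
  have twist: "twist r s \<le> 1" by (rule twist_le)
  consider (s) "w = (r, s, csucc a)" | (p) "w = (r, s, cpred a)" | (m) "w = mate r s a"
    using assms(2) by (auto simp: u nbrs_def)
  then show ?thesis
  proof cases
    case s
    show ?thesis unfolding u s by (rule j0[unfolded u s]) (rule joined_csucc[OF u(3)])
  next
    case p
    have "joined (P (r, s, cpred a)) (P (r, s, csucc (cpred a)))" using u by (intro joined_csucc) simp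
    from joined_sym[OF this] show ?thesis using u p by (intro j0) simp
  next
    case m
    consider (v) "a = 0" | (l) "a = m + 1" | (r) "a = m + 2 + twist r s"
      | (c) "0 < a" "a \<le> m" | (c') "a \<noteq> 0" "a \<noteq> m + 1" "a \<noteq> m + 2 + twist r s" "m < a"
      by linarith
    then show ?thesis
    proof cases
      case v
      then have w: "w = (vlink r s, s, 0)" using m by (simp add: mate_def)
      show ?thesis
      proof (cases "even (r + s)")
        case True
        then show ?thesis using joined_vertical[OF True] u v w by (intro j0) (simp add: vlink_def)
      next
        case False
        then have "r \<noteq> 0" using u by (auto simp: block_def)
        then have "joined (P (r - 1, s, 0)) (P (r, s, 0))"
          using joined_vertical[of "r - 1" s] False by simp
        from joined_sym[OF this] show ?thesis using u v w False by (intro j0) (simp add: vlink_def)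
      qed
    next
      case l
      then have w: "w = (r, rprev r s, m + 2 + twist r (rprev r s))" using m by (simp add: mate_def)
      obtain j where "joined (P w) (translate j (P u))"
        using joined_ring[OF block_rprev[OF u(2)]] rnext_rprev[OF u(2)] w u l by auto
      from joined_shift[OF joined_sym[OF this], of "- j"]
      have "joined (translate (- j) (translate j (P u))) (translate (- j) (P w))" .
      then show ?thesis unfolding translate_translate by auto
    next
      case r
      then show ?thesis using joined_ring[OF u(2)] u m by (simp add: mate_def)
    next
      case c
      then show ?thesis using joined_chord[OF c, of r s] u m by (intro j0) (simp add: mate_def)
    next
      case c'
      let ?b = "chord (twist r s) a"
      note cp = chord_props[OF twist u(3) c'(1-3)]
      have "0 < ?b" "?b \<le> m" using c' u(3) twist cp(2) by (auto simp: chord_def)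
      from joined_chord[OF this, of r s] have "joined (P (r, s, ?b)) (P (r, s, a))" using cp(5) by simp
      from joined_sym[OF this] show ?thesis using u m c' by (intro j0) (simp add: mate_def)
    qed
  qed
qed

lemma planar_wall: "planar wall"
proof -
  interpret pair_graph wall by (rule pair_graph_wall)
  have shd: "(fst p + j * (6 * int c), snd p) = translate j p" for p j by (simp add: translate_def)
  interpret cylinder_drawing wall "6 * int c" P LE
  proof (unfold_locales, unfold wall_simps shd)
    show "0 < 6 * int c" using c_ge by simp
  next
    fix u assume "u \<in> V" then show "0 \<le> snd (P u)" by (rule P_height)
  next
    fix u w j assume "u \<in> V" "w \<in> V" "snd (P u) = snd (P w)" "fst (P u) = fst (P w) + j * (6 * int c)"
    then show "u = w" by (rule P_inj)
  next
    fix p q assume "LE p q"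
    then show "snd p = snd q \<and> fst p < fst q \<and> fst q < fst p + 6 * int c \<or> snd q = snd p + 1"
      unfolding LE_def using hor_edge_shape ver_edge_shape by blast
  next
    fix p q j assume pq: "LE p q"
    have "(\<exists>u\<in>V. \<exists>i. translate j p = translate i (P u))" if "\<exists>u\<in>V. \<exists>i. p = translate i (P u)" for p
      using that translate_translate by blast
    then show "LE (translate j p) (translate j q)"
      using pq hor_edge_shift ver_edge_shift unfolding LE_def by blast
  next
    fix p q u j assume "LE p q" "snd p = snd q" "u \<in> V" "snd (P u) = snd p"
      "fst p < fst (P u) + j * (6 * int c)"
    then show "fst q \<le> fst (P u) + j * (6 * int c)"
      using hor_edge_between[of p q u j] ver_edge_shape[of p q] unfolding LE_def by auto
  next
    fix p q p' q' assume *: "LE p q" "LE p' q'" "snd q = snd p + 1" "snd q' = snd p' + 1" "snd p = snd p'"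
    then have "ver_edge p q" "ver_edge p' q'" using hor_edge_shape[of p q] hor_edge_shape[of p' q'] unfolding LE_def by auto
    then show "fst p \<le> fst p' \<and> fst q \<le> fst q' \<or> fst p' \<le> fst p \<and> fst q' \<le> fst q"
      using ver_edge_chain *(5) by blast
  next
    fix p q assume "LE p q"
    then show "(\<exists>u\<in>V. \<exists>j. p = translate j (P u)) \<and> (\<exists>u\<in>V. \<exists>j. q = translate j (P u))" unfolding LE_def by blast
  next
    fix u w assume uw: "u \<in> V \<and> w \<in> nbrs u"
    then obtain j where "joined (P u) (translate j (P w))" using joined_arc by blast
    moreover have "\<exists>u\<in>V. \<exists>j. translate j (P w) = translate j (P u)" "\<exists>v\<in>V. \<exists>i. translate j (P w) = translate i (P v)" "\<exists>v\<in>V. \<exists>j. P u = translate j (P v)"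
      using uw nbr_in_V translate_0 by metis+
    ultimately show "\<exists>j. LE (P u) (translate j (P w)) \<or> LE (translate j (P w)) (P u)"
      unfolding LE_def joined_def by blast
  qed
  show ?thesis by (rule planar_drawing)
qed

end

subsection \<open>The family of graphs\<close>

context ladder_wall
begin

text \<open>Ring 0 has no twisted ladders, so each is crossed along the edge from
  \<open>m + 1\<close> to \<open>m + 2\<close>. This long cycle bounds the circumference from
  below.\<close>

lemma ring_cycle: "2 * c \<in> cycle_spectrum wall"
proof (rule cycle_spectrumI)
  let ?v = "\<lambda>t::nat. (0 :: nat, 2 * (t div 2), if even t then m + 1 else m + 2)"
  show "pair_wf_digraph wall"
    using pair_graph_wall by (simp add: pair_graph_def pair_digraph_def pair_fin_digraph_def)
  show "3 \<le> 2 * c" using c_ge by simp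
  show "inj_on ?v {..<2 * c}"
  proof (rule inj_onI)
    fix t t' assume "?v t = ?v t'"
    then have "t div 2 = t' div 2" "even t = even t'" by (auto split: if_splits)
    then show "t = t'" by (metis dvd_mult_div_cancel odd_two_times_div_two_succ)
  qed
  fix t assume t: "t < 2 * c"
  then have block: "block 0 (2 * (t div 2))" by (auto simp: block_def)
  show "(?v t, ?v (Suc t mod (2 * c))) \<in> parcs wall"
  proof (cases "even t")
    case True
    then have "Suc t < 2 * c" using t by (auto elim!: evenE)
    then show ?thesis using True block m_pos by (auto simp: nbrs_def csucc_def)
  next
    case False
    then obtain i where i: "t = 2 * i + 1" by (rule oddE)
    have "rnext 0 (2 * i) = 2 * (Suc t mod (2 * c) div 2)"
    proof (cases "Suc t = 2 * c")
      case True
      then have "2 * i + stride 0 = 2 * c" using i by (simp add: stride_def)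
      then show ?thesis using True by (simp add: rnext_def)
    next
      case False
      then show ?thesis using t i by (simp add: rnext_def stride_def)
    qed
    moreover have "even (Suc t mod (2 * c))" using False by (simp add: dvd_mod)
    ultimately show ?thesis using block i m_pos by (auto simp: nbrs_def mate_def twist_def)
  qed
qed

lemma cycle_spectrum_wall:
  assumes "2 * m + 6 \<le> c" "n \<in> cycle_spectrum wall"
  shows "n \<le> M \<or> 4 * m + 11 \<le> n"
proof -
  obtain v :: "nat \<Rightarrow> nat \<times> nat \<times> nat" where v: "3 \<le> n" "inj_on v {..<n}"
      "\<And>i. i < n \<Longrightarrow> (v i, v (Suc i mod n)) \<in> parcs wall"
    using assms(2) by (rule cycle_spectrumD) auto
  interpret wall_cycle m c n v by unfold_locales (use v in auto)
  show ?thesis using assms(1) by (rule cycle_length)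
qed

end

text \<open>Different values of \<open>c\<close> give walls of different order, which are therefore
  not isomorphic.\<close>

lemma card_V_strict_mono:
  assumes "ladder_wall m c" "ladder_wall m c'" "c < c'"
  shows "card (ladder_wall.V m c) < card (ladder_wall.V m c')"
proof (rule psubset_card_mono)
  interpret a: ladder_wall m c by fact
  interpret b: ladder_wall m c' by fact
  show "finite b.V" by (rule b.finite_V)
  have "(1, 2 * c, 0) \<in> b.V" "(1, 2 * c, 0) \<notin> a.V"
    using assms(3) by (auto simp: a.block_def b.block_def)
  moreover have "a.V \<subseteq> b.V" using assms(3) by (auto simp: a.V_def b.V_def a.block_def b.block_def)
  ultimately show "a.V \<subset> b.V" by blast
qed

theorem mainTheorem1:
  fixes k :: nat
  assumes "even k" and "k \<ge> 6"
  shows "\<exists>S :: nat pair_pre_digraph set.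
    infinite S \<and>
    pairwise (\<lambda>G H. \<not> digraph_iso (with_proj G) (with_proj H)) S \<and>
    (\<forall>G \<in> S. pair_graph G \<and> vertex_connected 3 G \<and> cubic G \<and> planar G \<and>
      circumference G \<ge> k \<and> cycle_spectrum G \<inter> {k..2 * k + 2} = {})"
proof -
  obtain K where K: "k = 2 * K" using assms(1) by (rule evenE)
  \<comment> \<open>Chosen so that \<open>k = 2 * m + 4\<close>; the assumption
    \<open>k \<ge> 6\<close> is what makes \<open>1 \<le> m\<close>.\<close>
  define m where "m = K - 2"
  have k: "k = 2 * m + 4" "1 \<le> m" using assms(2) K by (auto simp: m_def)
  \<comment> \<open>Graphs on \<open>nat\<close> are required, whereas the walls live on
    triples.\<close>
  define f :: "nat \<times> nat \<times> nat \<Rightarrow> nat" where "f = to_nat"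
  have f: "inj f" by (simp add: f_def)
  define W where "W c = relabel f (ladder_wall.wall m c)" for c
  let ?C = "{2 * m + 6..}"
  have lw: "ladder_wall m c" if "c \<in> ?C" for c
    using that k(2) by unfold_locales auto
  have card_W: "card (verts (with_proj (W c))) = card (ladder_wall.V m c)" if "c \<in> ?C" for c
    using f ladder_wall.wall_simps(1)[OF lw[OF that]] by (simp add: W_def card_image inj_on_subset)
  have card_neq: "card (verts (with_proj (W c))) \<noteq> card (verts (with_proj (W c')))"
    if "c \<in> ?C" "c' \<in> ?C" "c \<noteq> c'" for c c'
    using card_V_strict_mono[OF lw lw, of c c'] card_V_strict_mono[OF lw lw, of c' c] card_W that
    by (cases c c' rule: linorder_cases) auto
  have "inj_on W ?C" using card_neq by (metis inj_onI)
  then have "infinite (W ` ?C)" using finite_imageD infinite_Ici by blast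
  moreover have "pairwise (\<lambda>G H. \<not> digraph_iso (with_proj G) (with_proj H)) (W ` ?C)"
  proof (rule pairwiseI)
    fix G H assume "G \<in> W ` ?C" "H \<in> W ` ?C" "G \<noteq> H"
    then obtain c c' where "c \<in> ?C" "c' \<in> ?C" "c \<noteq> c'" "G = W c" "H = W c'" by blast
    then show "\<not> digraph_iso (with_proj G) (with_proj H)"
      using card_neq[of c c'] card_verts_digraph_iso[of "with_proj G" "with_proj H"] by auto
  qed
  moreover have "pair_graph G \<and> vertex_connected 3 G \<and> cubic G \<and> planar G \<and>
      circumference G \<ge> k \<and> cycle_spectrum G \<inter> {k..2 * k + 2} = {}" if GW: "G \<in> W ` ?C" for G
  proof -
    obtain c where c: "2 * m + 6 \<le> c" and G: "G = relabel f (ladder_wall.wall m c)"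
      using GW by (auto simp: W_def)
    interpret ladder_wall m c using lw c by auto
    have pg: "pair_graph G" unfolding G by (rule pair_graph_relabel[OF f pair_graph_wall])
    have "2 * c \<in> cycle_spectrum G"
      unfolding G using cycle_spectrum_relabel_supset[OF f pair_graph_wall] ring_cycle by blast
    moreover have "finite (cycle_spectrum G)"
      using pg by (intro finite_cycle_spectrum) (simp add: pair_graph_def pair_digraph_def)
    ultimately have "2 * c \<le> circumference G" by (simp add: circumference_def)
    then have circ: "k \<le> circumference G" using c k by linarith
    have "n \<notin> {k..2 * k + 2}" if "n \<in> cycle_spectrum G" for n
    proof -
      have "n \<in> cycle_spectrum wall"
        using that cycle_spectrum_relabel[OF f pair_graph_wall] unfolding G by blast
      from cycle_spectrum_wall[OF c this] show ?thesis using k by auto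
    qed
    then have "cycle_spectrum G \<inter> {k..2 * k + 2} = {}" by blast
    then show ?thesis
      using pg circ vertex_connected_relabel[OF f vertex_connected_wall]
        cubic_relabel[OF f cubic_wall] planar_relabel[OF f planar_wall] unfolding G by blast
  qed
  ultimately show ?thesis by blast
qed

end
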